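(* Let $R$ be a complete valuation ring which is not a field, whose field of fractions $K$ (with induced absolute value $|\cdot|$) is algebraically closed. Consider the uniform structure on $K\times(1,\infty)$ induced by the fundamental system of entourages of the form $$\big\{\big((s_1,\omega_1),(s_2,\omega_2)\big): \big||\mathbf{p}(s_1)|^{\omega_1}-|\mathbf{p}(s_2)|^{\omega_2}\big|<\epsilon\ \text{ for each }\mathbf{p}\in X\big\},$$ where $\epsilon$ runs through all positive real numbers and $X$ runs through all non-empty finite subsets of $R[\mathbf{t}]$. Then, as a uniform space (with its Berkovich uniform structure), $\mathbb{A}_R^1$ is the completion of $K\times(1,\infty)$ under this uniform structure, the canonical map $K\times(1,\infty)\to\mathbb{A}_R^1$ sending $(s,\omega)$ to the seminorm $\mathbf{p}\mapsto|\mathbf{p}(s)|^\omega$ $(\mathbf{p}\in R[\mathbf{t}])$.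
   Context: A valuation ring is an integral domain $R$ with field of fractions $K$ such that for every non-zero $x\in K$, $x\in R$ or $x^{-1}\in R$. It is a complete valuation ring if the totally ordered group $K^\times/R^\times$ is isomorphic to an ordered subgroup of $\mathbb{R}$ and $R$ is complete under the induced norm; equivalently, $R=\{a\in K:|a|\le1\}$ for a complete non-Archimedean valued field $(K,|\cdot|)$. $R$ carries the norm $|\cdot|$. $\mathbb{A}_R^1$ is the set of all non-zero multiplicative seminorms $\lambda$, written $\mathbf{p}\mapsto|\mathbf{p}|_\lambda$, on the polynomial ring $R[\mathbf{t}]$ whose restrictions to $R$ are contractive ($|a|_\lambda\le|a|$ for $a\in R$). Its Berkovich uniform structure is given by the fundamental system of entourages $E_\epsilon^X:=\{(\mu,\nu)\in\mathbb{A}_R^1\times\mathbb{A}_R^1: \big||\mathbf{p}|_\mu-|\mathbf{p}|_\nu\big|<\epsilon \text{ for any }\mathbf{p}\in X\}$, where $\epsilon$ runs through the strictly positive reals and $X$ through the non-empty finite subsets of $R[\mathbf{t}]$; it induces the topology of pointwise convergence. *)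

theory Defs
  imports
    "HOL-Analysis.Analysis"
    "HOL-Computational_Algebra.Polynomial_Factorial"
begin

section \<open>Uniform spaces on a carrier set\<close>

text \<open>
  The library class \<open>uniform_space\<close> puts a uniformity on a whole type.  Here the carrier depends on
  a term (a norm), so the same axioms are stated relative to a set \<open>S\<close>, the uniformity being the
  filter of entourages on pairs.
\<close>

definition uniform_structure :: "'x set \<Rightarrow> ('x \<times> 'x) filter \<Rightarrow> bool" where
  "uniform_structure S U \<longleftrightarrow>
     U \<le> principal (S \<times> S) \<and>
     (\<forall>E. eventually E U \<longrightarrow> (\<forall>x\<in>S. E (x, x))) \<and>
     (\<forall>E. eventually E U \<longrightarrow> eventually (\<lambda>(x, y). E (y, x)) U) \<and>
     (\<forall>E. eventually E U \<longrightarrow>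
        (\<exists>D. eventually D U \<and> (\<forall>x y z. D (x, y) \<longrightarrow> D (y, z) \<longrightarrow> E (x, z))))"

definition uniform_topology :: "'x set \<Rightarrow> ('x \<times> 'x) filter \<Rightarrow> 'x topology" where
  "uniform_topology S U =
     topology (\<lambda>W. W \<subseteq> S \<and> (\<forall>x\<in>W. eventually (\<lambda>(x', y). x' = x \<longrightarrow> y \<in> W) U))"

lemma openin_uniform_topology:
  "openin (uniform_topology S U) W \<longleftrightarrow>
     W \<subseteq> S \<and> (\<forall>x\<in>W. eventually (\<lambda>(x', y). x' = x \<longrightarrow> y \<in> W) U)"
proof -
  have "istopology (\<lambda>W. W \<subseteq> S \<and> (\<forall>x\<in>W. eventually (\<lambda>(x', y). x' = x \<longrightarrow> y \<in> W) U))"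
    unfolding istopology_def
  proof (intro conjI allI impI)
    fix V W
    assume "V \<subseteq> S \<and> (\<forall>x\<in>V. eventually (\<lambda>(x', y). x' = x \<longrightarrow> y \<in> V) U)"
      and "W \<subseteq> S \<and> (\<forall>x\<in>W. eventually (\<lambda>(x', y). x' = x \<longrightarrow> y \<in> W) U)"
    note VW = this
    show "V \<inter> W \<subseteq> S" using VW by blast
    show "\<forall>x\<in>V \<inter> W. eventually (\<lambda>(x', y). x' = x \<longrightarrow> y \<in> V \<inter> W) U"
    proof
      fix x assume "x \<in> V \<inter> W"
      with VW have "eventually (\<lambda>(x', y). x' = x \<longrightarrow> y \<in> V) U"
        and "eventually (\<lambda>(x', y). x' = x \<longrightarrow> y \<in> W) U" by blast+
      then show "eventually (\<lambda>(x', y). x' = x \<longrightarrow> y \<in> V \<inter> W) U"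
        by eventually_elim auto
    qed
  next
    fix \<K>
    assume *: "\<forall>K\<in>\<K>. K \<subseteq> S \<and> (\<forall>x\<in>K. eventually (\<lambda>(x', y). x' = x \<longrightarrow> y \<in> K) U)"
    then show "\<Union>\<K> \<subseteq> S" by blast
    show "\<forall>x\<in>\<Union>\<K>. eventually (\<lambda>(x', y). x' = x \<longrightarrow> y \<in> \<Union>\<K>) U"
    proof
      fix x assume "x \<in> \<Union>\<K>"
      then obtain K where K: "K \<in> \<K>" "x \<in> K" by blast
      with * have "eventually (\<lambda>(x', y). x' = x \<longrightarrow> y \<in> K) U" by blast
      then show "eventually (\<lambda>(x', y). x' = x \<longrightarrow> y \<in> \<Union>\<K>) U"
        by (rule eventually_mono) (use K in auto)
    qed
  qed
  then show ?thesis
    unfolding uniform_topology_def by simp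
qed

lemma topspace_uniform_topology:
  assumes "uniform_structure S U"
  shows "topspace (uniform_topology S U) = S"
proof -
  have "eventually (\<lambda>z. z \<in> S \<times> S) U"
    using assms unfolding uniform_structure_def le_principal by blast
  then have "eventually (\<lambda>(x', y). x' = x \<longrightarrow> y \<in> S) U" for x
    by (rule eventually_mono) auto
  then have "openin (uniform_topology S U) S"
    unfolding openin_uniform_topology by blast
  moreover have "topspace (uniform_topology S U) \<subseteq> S"
    using openin_topspace[of "uniform_topology S U"] unfolding openin_uniform_topology by blast
  ultimately show ?thesis
    by (meson openin_subset subset_antisym)
qed

definition complete_uniform_structure :: "'x set \<Rightarrow> ('x \<times> 'x) filter \<Rightarrow> bool" where
  "complete_uniform_structure S U \<longleftrightarrow>
     (\<forall>F. F \<noteq> bot \<longrightarrow> F \<le> principal S \<longrightarrow> F \<times>\<^sub>F F \<le> U \<longrightarrow>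
        (\<exists>l. limitin (uniform_topology S U) (\<lambda>x. x) l F))"

text \<open>
  \<open>(T, V)\<close> with the map \<open>i\<close> is the completion of \<open>(S, U)\<close>: a complete Hausdorff uniform space
  containing, via \<open>i\<close>, the uniform space \<open>(S, U)\<close> as a dense uniform subspace.
\<close>

definition is_completion ::
    "'x set \<Rightarrow> ('x \<times> 'x) filter \<Rightarrow> 'y set \<Rightarrow> ('y \<times> 'y) filter \<Rightarrow> ('x \<Rightarrow> 'y) \<Rightarrow> bool" where
  "is_completion S U T V i \<longleftrightarrow>
     uniform_structure S U \<and>
     uniform_structure T V \<and>
     complete_uniform_structure T V \<and>
     Hausdorff_space (uniform_topology T V) \<and>
     i ` S \<subseteq> T \<and>
     inj_on i S \<and>
     U = inf (filtercomap (map_prod i i) V) (principal (S \<times> S)) \<and>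
     uniform_topology T V closure_of (i ` S) = T"

section \<open>Complete valuation rings\<close>

text \<open>
  The ring \<open>R\<close> is a type \<open>'a::idom\<close>, and \<open>K\<close> is the type \<open>'a fract\<close>, in which \<open>R\<close> is
  \<open>range to_fract\<close>.
\<close>

definition valuation_ring :: "'a::idom itself \<Rightarrow> bool" where
  "valuation_ring _ \<longleftrightarrow>
     (\<forall>x :: 'a fract. x \<noteq> 0 \<longrightarrow> x \<in> range to_fract \<or> inverse x \<in> range to_fract)"

text \<open>
  A norm on \<open>K\<close> given by an embedding of the ordered group \<open>K\<^sup>\<times> / R\<^sup>\<times>\<close> (where the class of \<open>x\<close> is
  at most that of \<open>y\<close> iff \<open>x / y\<close> lies in \<open>R\<close>) into the positive reals under multiplication, a
  group isomorphic to the additive reals by the logarithm.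
\<close>

definition induced_norm :: "('a::idom fract \<Rightarrow> real) \<Rightarrow> bool" where
  "induced_norm v \<longleftrightarrow>
     v 0 = 0 \<and>
     (\<forall>x. x \<noteq> 0 \<longrightarrow> v x > 0) \<and>
     (\<forall>x y. v (x * y) = v x * v y) \<and>
     (\<forall>x y. x \<noteq> 0 \<longrightarrow> y \<noteq> 0 \<longrightarrow> (v x \<le> v y \<longleftrightarrow> x / y \<in> range to_fract))"

text \<open>A complete valuation ring together with the norm \<open>v\<close> it carries, extended to \<open>K\<close>.\<close>

definition complete_valuation_ring :: "('a::idom fract \<Rightarrow> real) \<Rightarrow> bool" where
  "complete_valuation_ring v \<longleftrightarrow>
     valuation_ring TYPE('a) \<and>
     induced_norm v \<and>
     (\<forall>X :: nat \<Rightarrow> 'a.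
        (\<forall>\<epsilon>>0. \<exists>N. \<forall>m\<ge>N. \<forall>n\<ge>N. v (to_fract (X m - X n)) < \<epsilon>) \<longrightarrow>
        (\<exists>l. (\<lambda>n. v (to_fract (X n - l))) \<longlonglongrightarrow> 0))"

definition nonarchimedean_abs :: "('k::field \<Rightarrow> real) \<Rightarrow> bool" where
  "nonarchimedean_abs v \<longleftrightarrow>
     (\<forall>x. v x \<ge> 0) \<and> (\<forall>x. v x = 0 \<longleftrightarrow> x = 0) \<and>
     (\<forall>x y. v (x * y) = v x * v y) \<and>
     (\<forall>x y. v (x + y) \<le> max (v x) (v y))"

lemma nonarchimedean_abs_1:
  assumes "nonarchimedean_abs v"
  shows "v 1 = 1" and "v (- x) = v x"
proof -
  have nn: "v y \<ge> 0" and z: "v y = 0 \<longleftrightarrow> y = 0" and m: "v (y * y') = v y * v y'" for y y'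
    using assms unfolding nonarchimedean_abs_def by blast+
  show 1: "v 1 = 1" using m[of 1 1] z[of 1] by simp
  have "(v (-1))\<^sup>2 = 1" using m[of "-1" "-1"] 1 by (simp add: power2_eq_square)
  then have "v (-1) = 1" using nn[of "-1"] by (auto simp: power2_eq_1_iff)
  then show "v (- x) = v x" using m[of "-1" x] by simp
qed

lemma induced_norm_iff:
  fixes v :: "'a::idom fract \<Rightarrow> real"
  shows "induced_norm v \<longleftrightarrow> nonarchimedean_abs v \<and> range to_fract = {x. v x \<le> 1}"
proof
  assume v: "induced_norm v"
  then have v0: "v 0 = 0" and vpos: "\<And>x. x \<noteq> 0 \<Longrightarrow> v x > 0"
    and vmult: "\<And>x y. v (x * y) = v x * v y"
    and vle: "\<And>x y. x \<noteq> 0 \<Longrightarrow> y \<noteq> 0 \<Longrightarrow> v x \<le> v y \<longleftrightarrow> x / y \<in> range to_fract"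
    unfolding induced_norm_def by blast+
  have vnn: "v x \<ge> 0" for x using v0 vpos[of x] by (cases "x = 0") auto
  have vz: "v x = 0 \<longleftrightarrow> x = 0" for x using v0 vpos[of x] by (cases "x = 0") auto
  have v1: "v 1 = 1" using vmult[of 1 1] vpos[of 1] by simp
  have R: "range to_fract = {x. v x \<le> 1}"
  proof (rule set_eqI)
    fix x :: "'a fract"
    show "x \<in> range to_fract \<longleftrightarrow> x \<in> {x. v x \<le> 1}"
    proof (cases "x = 0")
      case True
      then show ?thesis using v0 by (auto intro: range_eqI[of _ _ 0])
    next
      case False
      then show ?thesis using vle[of x 1] v1 by simp
    qed
  qed
  have ultra: "v (x + y) \<le> v y" if "v x \<le> v y" for x y
  proof (cases "y = 0")
    case True
    with that v0 vpos[of x] show ?thesis by (cases "x = 0") auto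
  next
    case False
    have "v (x / y) * v y = v x" using vmult[of "x / y" y] False by simp
    then have "v (x / y) * v y \<le> 1 * v y" using that by simp
    then have "v (x / y) \<le> 1" using vpos[OF False] by (simp only: mult_le_cancel_right_pos)
    then obtain a where "x / y = to_fract a" using R by blast
    then have "x / y + 1 = to_fract (a + 1)" by simp
    then have "v (x / y + 1) \<le> 1" using R by blast
    moreover have "v (x + y) = v (x / y + 1) * v y"
      using vmult[of "x / y + 1" y] False by (simp add: distrib_right)
    ultimately show ?thesis using vnn[of y] by (simp add: mult_left_le_one_le vnn)
  qed
  have "v (x + y) \<le> max (v x) (v y)" for x y
    using ultra[of x y] ultra[of y x] by (cases "v x \<le> v y") (auto simp: add.commute max_def)
  then have "nonarchimedean_abs v"
    unfolding nonarchimedean_abs_def using vnn vmult vz by blast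
  with R show "nonarchimedean_abs v \<and> range to_fract = {x. v x \<le> 1}" by blast
next
  assume *: "nonarchimedean_abs v \<and> range to_fract = {x. v x \<le> 1}"
  then have N: "nonarchimedean_abs v" and R: "range to_fract = {x. v x \<le> 1}"
    by (rule conjunct1, rule conjunct2)
  have vnn: "v x \<ge> 0" and vz: "v x = 0 \<longleftrightarrow> x = 0" and vmult: "v (x * y) = v x * v y" for x y
    using N unfolding nonarchimedean_abs_def by blast+
  have vpos: "v x > 0" if "x \<noteq> 0" for x
    using vnn[of x] vz[of x] that by linarith
  have "v x \<le> v y \<longleftrightarrow> x / y \<in> range to_fract" if "x \<noteq> 0" "y \<noteq> 0" for x y
  proof -
    have "v (x / y) * v y = v x" using vmult[of "x / y" y] that by simp
    then have "v x \<le> v y \<longleftrightarrow> v (x / y) * v y \<le> 1 * v y" by (simp only: mult_1_left)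
    also have "\<dots> \<longleftrightarrow> v (x / y) \<le> 1"
      using vpos[OF \<open>y \<noteq> 0\<close>] by (simp only: mult_le_cancel_right_pos)
    finally have "v x \<le> v y \<longleftrightarrow> v (x / y) \<le> 1" .
    then show ?thesis using R by blast
  qed
  then show "induced_norm v"
    unfolding induced_norm_def using vz[of 0] vpos vmult by simp
qed

text \<open>The equivalent description by a complete non-Archimedean valued field.\<close>

lemma complete_valuation_ring_iff:
  fixes v :: "'a::idom fract \<Rightarrow> real"
  shows "complete_valuation_ring v \<longleftrightarrow>
    nonarchimedean_abs v \<and>
    (\<forall>X :: nat \<Rightarrow> 'a fract.
       (\<forall>\<epsilon>>0. \<exists>N. \<forall>m\<ge>N. \<forall>n\<ge>N. v (X m - X n) < \<epsilon>) \<longrightarrow> (\<exists>l. (\<lambda>n. v (X n - l)) \<longlonglongrightarrow> 0)) \<and>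
    range to_fract = {x. v x \<le> 1}"
    (is "?L \<longleftrightarrow> ?N \<and> ?C \<and> ?R")
proof
  assume L: ?L
  then have N: ?N and R: ?R
    unfolding complete_valuation_ring_def induced_norm_iff by blast+
  have ?C
  proof (intro allI impI)
    fix X :: "nat \<Rightarrow> 'a fract"
    assume X: "\<forall>\<epsilon>>0. \<exists>N. \<forall>m\<ge>N. \<forall>n\<ge>N. v (X m - X n) < \<epsilon>"
    then obtain k where k: "\<And>m n. m \<ge> k \<Longrightarrow> n \<ge> k \<Longrightarrow> v (X m - X n) < 1"
      by (meson zero_less_one)
    have "X (n + k) - X k \<in> range to_fract" for n
      using R k[of "n + k" k] by auto
    then have "\<forall>n. \<exists>a. X (n + k) - X k = to_fract a" by blast
    then obtain Y where Y: "\<And>n. X (n + k) - X k = to_fract (Y n)" by metis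
    have eq: "to_fract (Y m - Y n) = X (m + k) - X (n + k)" for m n
      by (simp flip: Y)
    have "\<forall>\<epsilon>>0. \<exists>N. \<forall>m\<ge>N. \<forall>n\<ge>N. v (to_fract (Y m - Y n)) < \<epsilon>"
      unfolding eq using X by (meson le_add1 order_trans)
    then obtain l where l: "(\<lambda>n. v (to_fract (Y n - l))) \<longlonglongrightarrow> 0"
      using L unfolding complete_valuation_ring_def by blast
    have "to_fract (Y n - l) = X (n + k) - (X k + to_fract l)" for n
      by (simp flip: Y)
    with l have "(\<lambda>n. v (X (n + k) - (X k + to_fract l))) \<longlonglongrightarrow> 0" by (simp only:)
    then show "\<exists>l. (\<lambda>n. v (X n - l)) \<longlonglongrightarrow> 0"
      by (intro exI[of _ "X k + to_fract l"])
         (rule LIMSEQ_offset[where f = "\<lambda>n. v (X n - (X k + to_fract l))"])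
  qed
  with N R show "?N \<and> ?C \<and> ?R" by blast
next
  assume *: "?N \<and> ?C \<and> ?R"
  have N: ?N using * by (elim conjE)
  have C: ?C using * by (elim conjE)
  have R: ?R using * by (elim conjE)
  have vr: "valuation_ring TYPE('a)"
    unfolding valuation_ring_def
  proof (intro allI impI)
    fix x :: "'a fract" assume "x \<noteq> 0"
    then have "v x * v (inverse x) = 1"
      using N nonarchimedean_abs_1(1)[OF N] unfolding nonarchimedean_abs_def
      by (metis right_inverse)
    moreover have "v x \<ge> 0" "v (inverse x) \<ge> 0"
      using N unfolding nonarchimedean_abs_def by blast+
    ultimately have "v x \<le> 1 \<or> v (inverse x) \<le> 1"
      using less_1_mult[of "v x" "v (inverse x)"] by linarith
    then show "x \<in> range to_fract \<or> inverse x \<in> range to_fract" using R by blast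
  qed
  have "\<exists>l. (\<lambda>n. v (to_fract (X n - l))) \<longlonglongrightarrow> 0"
    if X: "\<forall>\<epsilon>>0. \<exists>N. \<forall>m\<ge>N. \<forall>n\<ge>N. v (to_fract (X m - X n)) < \<epsilon>" for X :: "nat \<Rightarrow> 'a"
  proof -
    have "\<forall>\<epsilon>>0. \<exists>N. \<forall>m\<ge>N. \<forall>n\<ge>N. v (to_fract (X m) - to_fract (X n)) < \<epsilon>"
      using X by simp
    then obtain y where y: "(\<lambda>n. v (to_fract (X n) - y)) \<longlonglongrightarrow> 0"
      using C[rule_format, of "\<lambda>n. to_fract (X n)"] by blast
    then have "eventually (\<lambda>n. v (to_fract (X n) - y) < 1) sequentially"
      by (rule order_tendstoD) simp
    then obtain n where n: "v (to_fract (X n) - y) < 1"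
      using eventually_happens'[OF sequentially_bot] by blast
    have "v (to_fract (X n)) \<le> 1" using R by blast
    moreover have "v (to_fract (X n) + (y - to_fract (X n)))
        \<le> max (v (to_fract (X n))) (v (y - to_fract (X n)))"
      using N unfolding nonarchimedean_abs_def by blast
    moreover have "v (y - to_fract (X n)) = v (to_fract (X n) - y)"
      using nonarchimedean_abs_1(2)[OF N, of "to_fract (X n) - y"] by simp
    ultimately have "v y \<le> 1" using n by simp
    then obtain l where "y = to_fract l" using R by blast
    with y show ?thesis by auto
  qed
  with vr N R show ?L
    unfolding complete_valuation_ring_def induced_norm_iff by simp
qed

section \<open>The Berkovich affine line and its uniform structure\<close>

definition multiplicative_seminorm :: "('r::comm_ring_1 \<Rightarrow> real) \<Rightarrow> bool" where
  "multiplicative_seminorm \<mu> \<longleftrightarrow>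
     \<mu> 0 = 0 \<and> (\<forall>p. \<mu> p \<ge> 0) \<and>
     (\<forall>p q. \<mu> (p + q) \<le> \<mu> p + \<mu> q) \<and>
     (\<forall>p q. \<mu> (p * q) = \<mu> p * \<mu> q)"

definition berkovich_line :: "('a::idom fract \<Rightarrow> real) \<Rightarrow> ('a poly \<Rightarrow> real) set" where
  "berkovich_line v =
     {\<mu>. multiplicative_seminorm \<mu> \<and> (\<exists>p. \<mu> p \<noteq> 0) \<and> (\<forall>a. \<mu> [:a:] \<le> v (to_fract a))}"

definition berkovich_entourage ::
    "('a::idom fract \<Rightarrow> real) \<Rightarrow> 'a poly set \<Rightarrow> real \<Rightarrow> (('a poly \<Rightarrow> real) \<times> ('a poly \<Rightarrow> real)) set" where
  "berkovich_entourage v X \<epsilon> =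
     {(\<mu>, \<nu>) \<in> berkovich_line v \<times> berkovich_line v. \<forall>p\<in>X. \<bar>\<mu> p - \<nu> p\<bar> < \<epsilon>}"

definition berkovich_uniformity ::
    "('a::idom fract \<Rightarrow> real) \<Rightarrow> (('a poly \<Rightarrow> real) \<times> ('a poly \<Rightarrow> real)) filter" where
  "berkovich_uniformity v =
     (INF (X, \<epsilon>) \<in> {X. finite X \<and> X \<noteq> {}} \<times> {0<..}. principal (berkovich_entourage v X \<epsilon>))"

definition evaluation_seminorm :: "('a::idom fract \<Rightarrow> real) \<Rightarrow> 'a fract \<times> real \<Rightarrow> 'a poly \<Rightarrow> real" where
  "evaluation_seminorm v = (\<lambda>(s, \<omega>) p. v (poly (fract_poly p) s) powr \<omega>)"

definition evaluation_entourage ::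
    "('a::idom fract \<Rightarrow> real) \<Rightarrow> 'a poly set \<Rightarrow> real \<Rightarrow> (('a fract \<times> real) \<times> ('a fract \<times> real)) set" where
  "evaluation_entourage v X \<epsilon> =
     {((s\<^sub>1, \<omega>\<^sub>1), (s\<^sub>2, \<omega>\<^sub>2)). \<omega>\<^sub>1 > 1 \<and> \<omega>\<^sub>2 > 1 \<and>
        (\<forall>p\<in>X. \<bar>v (poly (fract_poly p) s\<^sub>1) powr \<omega>\<^sub>1 - v (poly (fract_poly p) s\<^sub>2) powr \<omega>\<^sub>2\<bar> < \<epsilon>)}"

definition evaluation_uniformity ::
    "('a::idom fract \<Rightarrow> real) \<Rightarrow> (('a fract \<times> real) \<times> ('a fract \<times> real)) filter" where
  "evaluation_uniformity v =
     (INF (X, \<epsilon>) \<in> {X. finite X \<and> X \<noteq> {}} \<times> {0<..}. principal (evaluation_entourage v X \<epsilon>))"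

text \<open>The entourages above form bases of the filters they generate.\<close>

lemma eventually_INF_finite_sets_eps:
  fixes E :: "'p set \<Rightarrow> real \<Rightarrow> 'x set"
  assumes mono: "\<And>X Y \<delta> \<epsilon>. X \<subseteq> Y \<Longrightarrow> \<delta> \<le> \<epsilon> \<Longrightarrow> E Y \<delta> \<subseteq> E X \<epsilon>"
  shows "eventually P (INF (X, \<epsilon>) \<in> {X. finite X \<and> X \<noteq> {}} \<times> {0<..}. principal (E X \<epsilon>)) \<longleftrightarrow>
    (\<exists>X \<epsilon>. finite X \<and> X \<noteq> {} \<and> \<epsilon> > 0 \<and> (\<forall>z \<in> E X \<epsilon>. P z))"
proof -
  let ?B = "{X :: 'p set. finite X \<and> X \<noteq> {}} \<times> {0 :: real<..}"
  have "eventually P (INF b \<in> ?B. principal (E (fst b) (snd b))) \<longleftrightarrow>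
      (\<exists>b\<in>?B. eventually P (principal (E (fst b) (snd b))))"
  proof (rule eventually_INF_base)
    have "({undefined}, 1) \<in> ?B" by simp
    then show "?B \<noteq> {}" by blast
  next
    fix a b assume a: "a \<in> ?B" and b: "b \<in> ?B"
    define c where "c = (fst a \<union> fst b, min (snd a) (snd b))"
    have "c \<in> ?B" using a b by (auto simp: c_def)
    moreover have "E (fst c) (snd c) \<subseteq> E (fst a) (snd a)" "E (fst c) (snd c) \<subseteq> E (fst b) (snd b)"
      unfolding c_def fst_conv snd_conv by (rule mono; simp)+
    ultimately show "\<exists>x\<in>?B. principal (E (fst x) (snd x)) \<le>
        inf (principal (E (fst a) (snd a))) (principal (E (fst b) (snd b)))"
      by (intro bexI[of _ c]) (auto simp: inf_principal)
  qed
  then show ?thesis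
    by (simp add: case_prod_beta eventually_principal Bex_def conj_ac)
qed

lemma eventually_berkovich_uniformity:
  "eventually P (berkovich_uniformity v) \<longleftrightarrow>
    (\<exists>X \<epsilon>. finite X \<and> X \<noteq> {} \<and> \<epsilon> > 0 \<and> (\<forall>z \<in> berkovich_entourage v X \<epsilon>. P z))"
  unfolding berkovich_uniformity_def
  by (rule eventually_INF_finite_sets_eps) (fastforce simp: berkovich_entourage_def)

lemma eventually_evaluation_uniformity:
  "eventually P (evaluation_uniformity v) \<longleftrightarrow>
    (\<exists>X \<epsilon>. finite X \<and> X \<noteq> {} \<and> \<epsilon> > 0 \<and> (\<forall>z \<in> evaluation_entourage v X \<epsilon>. P z))"
  unfolding evaluation_uniformity_def
  by (rule eventually_INF_finite_sets_eps) (fastforce simp: evaluation_entourage_def)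

end

theory Submission
  imports Defs
begin

text \<open>
  The line is complete and Hausdorff because it is closed in the product of copies of the reals
  indexed by the polynomials (\<open>complete_berkovich\<close>, \<open>Hausdorff_berkovich\<close>), and the entourages on
  \<open>K \<times> (1, \<infinity>)\<close> are by definition the preimages of those on the line. The exponent and the zeros of
  the linear polynomials can be read off from an evaluation, so the map is injective. What remains
  is density: every point \<open>\<mu>\<close> of the line is a limit of evaluations, and even of a sequence of them.

  On \<open>R\<close> the seminorm \<open>\<mu>\<close> is either a power \<open>\<omega> \<in> [1, \<infinity>)\<close> of the absolute value or, as the limiting
  case \<open>\<omega> = \<infinity>\<close>, trivial on the residue field and zero on the maximal ideal
  (\<open>berkovich_line_constants\<close>). Since \<open>K\<close> is algebraically closed, every polynomial over \<open>R\<close> is a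
  product of a constant in \<open>R\<close>, of factors \<open>t - a\<close> with \<open>a\<close> in \<open>R\<close> and of factors \<open>1 - b t\<close> with \<open>b\<close>
  in the maximal ideal (\<open>linear_factor_over_valuation_ring\<close>). Both \<open>\<mu>\<close> and evaluations being
  multiplicative, convergence needs to be arranged for constants and linear polynomials only.

  For finite \<open>\<omega>\<close>, the values of \<open>\<mu>\<close> at the polynomials \<open>t - a\<close> amount to the distance function of a
  disc in \<open>K\<close>, or of a decreasing sequence of discs. The value group of \<open>K\<close> is dense, so there are
  points whose distance from the centre is slightly above the radius, and these have the right
  limiting distance from every \<open>a\<close> (\<open>disc_function_limit\<close>). For \<open>\<omega> = \<infinity>\<close>, let the exponents tend to
  infinity and choose the points such that one absolute value, raised to the exponent, has the
  prescribed limit (\<open>berkovich_line_limit_infinite_exponent\<close>).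
\<close>

section \<open>Non-Archimedean absolute values with dense value group\<close>

lemma nonarchimedean_absD:
  assumes "nonarchimedean_abs v"
  shows "v x \<ge> 0" "v x = 0 \<longleftrightarrow> x = 0" "v (x * y) = v x * v y"
    "v (x + y) \<le> max (v x) (v y)" "v 1 = 1" "v (- x) = v x" "v (x - y) \<le> max (v x) (v y)"
    "v (x - y) = v (y - x)" "v (x ^ n) = v x ^ n" "v 0 = 0"
    "y \<noteq> 0 \<Longrightarrow> v (x / y) = v x / v y"
proof -
  show 1: "v x \<ge> 0" "v x = 0 \<longleftrightarrow> x = 0" "v (x * y) = v x * v y"
    "v (x + y) \<le> max (v x) (v y)" for x y
    using assms unfolding nonarchimedean_abs_def by blast+
  show 2: "v 1 = 1" "v (- x) = v x" for x
    using nonarchimedean_abs_1[OF assms] by auto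
  show "v (x - y) \<le> max (v x) (v y)" using 1(4)[of x "- y"] 2 by simp
  show "v (x - y) = v (y - x)" using 2(2)[of "x - y"] by simp
  show "v (x ^ n) = v x ^ n" by (induction n) (simp_all add: 1 2)
  show "v 0 = 0" by (simp add: 1)
  show "v (x / y) = v x / v y" if "y \<noteq> 0"
    using 1(3)[of "x / y" y] 1(2)[of y] that by (simp add: field_simps)
qed

lemma nonarchimedean_dominant:
  assumes v: "nonarchimedean_abs v" and "v y < v x"
  shows "v (x + y) = v x" "v (x - y) = v x"
proof -
  note D = nonarchimedean_absD[OF v]
  show "v (x + y) = v x" using D(4)[of x y] D(7)[of "x + y" y] assms(2) by auto
  show "v (x - y) = v x" using D(7)[of x y] D(4)[of "x - y" y] assms(2) by auto
qed

text \<open>An \<open>n\<close>-th root of \<open>c\<close> has the absolute value \<open>v c powr (1 / n)\<close>, which is close to \<open>1\<close> for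
  large \<open>n\<close>, so that some integral power of it falls into a given interval.\<close>

lemma algebraically_closed_dense_values:
  fixes v :: "'k::field \<Rightarrow> real"
  assumes v: "nonarchimedean_abs v"
    and alg_closed: "\<And>p :: 'k poly. degree p > 0 \<Longrightarrow> \<exists>x. poly p x = 0"
    and c: "0 < v c" "v c < 1"
    and lh: "0 \<le> lo" "lo < hi"
  obtains x where "lo < v x" "v x < hi"
proof -
  note D = nonarchimedean_absD[OF v]
  define l where "l = max lo (hi / 2)"
  have l: "0 < l" "l < hi" "lo \<le> l" using lh by (auto simp: l_def max_def)
  define d where "d = ln hi - ln l"
  have d: "d > 0" using l by (simp add: d_def)
  define L where "L = - ln (v c)"
  have L: "L > 0" using c by (simp add: L_def)
  obtain n :: nat where n: "real n > L / d" using reals_Archimedean2 by blast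
  then have n0: "n > 0" using L d by (cases n) (auto simp: field_simps)
  have "degree (monom 1 n - [:c:]) = n"
    using n0 by (subst diff_conv_add_uminus, subst degree_add_eq_left) (auto simp: degree_monom_eq)
  then obtain z where "poly (monom 1 n - [:c:]) z = 0"
    using alg_closed n0 by metis
  then have z: "z ^ n = c" by (simp add: poly_monom)
  then have "v z ^ n = v c" using D(9)[of z n] by simp
  then have vz0: "v z > 0" using c(1) D(1)[of z] n0 by (cases "v z = 0") (auto simp: power_0_left)
  then have lnz: "real n * ln (v z) = - L"
    unfolding L_def using \<open>v z ^ n = v c\<close> by (metis ln_realpow minus_minus)
  define e where "e = - ln (v z)"
  have ne: "real n * e = L" using lnz by (simp add: e_def)
  have e0: "e > 0" using ne L n0 by (metis of_nat_0_less_iff zero_less_mult_pos)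
  have ed: "e < d"
  proof -
    have "real n * e < real n * d" using ne n d by (simp add: field_simps)
    then show ?thesis using n0 by simp
  qed
  \<comment> \<open>the largest multiple of \<open>e\<close> below \<open>ln hi\<close>; being less than \<open>e < d\<close> away from
     \<open>ln hi\<close>, it exceeds \<open>ln l\<close>\<close>
  define k where "k = \<lceil>ln hi / e\<rceil> - 1"
  have "real_of_int k < ln hi / e" "ln hi / e \<le> real_of_int k + 1"
    unfolding k_def by linarith+
  then have k: "k * e < ln hi" "ln hi \<le> k * e + e"
    using e0 by (auto simp: field_simps)
  define w where "w = (if k \<ge> 0 then inverse z else z)"
  define x where "x = w ^ nat \<bar>k\<bar>"
  have z0: "z \<noteq> 0" using vz0 D(2)[of z] by auto
  have viz: "v (inverse z) = inverse (v z)"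
    using D(11)[OF z0, of 1] D(5) by (simp add: inverse_eq_divide)
  have vw: "v w > 0" using vz0 viz by (simp add: w_def)
  have "ln (v w) = (if k \<ge> 0 then e else - e)"
    using viz vz0 by (simp add: w_def e_def ln_inverse)
  then have lx: "ln (v x) = k * e"
    unfolding x_def D(9) using vw by (simp add: ln_realpow)
  have vx: "v x > 0" unfolding x_def D(9) using vw by simp
  have "v x < hi" using lx k(1) vx l by (metis ln_less_cancel_iff order_less_trans)
  moreover have "ln l < ln (v x)" using lx k ed d_def by linarith
  then have "l < v x" using vx l by simp
  ultimately show ?thesis using that l(3) by force
qed

text \<open>A function \<open>r\<close> with the properties below is the distance function
  \<open>a \<mapsto> max r\<^sub>0 (v (a - b))\<close> of a closed disc, or a decreasing limit of such functions. A point
  at a distance from the centre slightly above the radius, rather than equal to it, keeps the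
  right distance from every given \<open>a\<close>; in this way no information on the residue
  field enters.\<close>

lemma disc_function_limit:
  fixes v :: "'k::field \<Rightarrow> real"
  assumes v: "nonarchimedean_abs v"
    and dense: "\<And>lo hi. 0 \<le> lo \<Longrightarrow> lo < hi \<Longrightarrow> \<exists>x. lo < v x \<and> v x < hi"
    and r0: "\<And>a. r a \<ge> 0"
    and r1: "\<And>a b. r a \<le> max (r b) (v (a - b))"
    and r2: "\<And>a b. v (a - b) \<le> max (r a) (r b)"
  obtains s where "\<And>a. (\<lambda>n. v (s n - a)) \<longlonglongrightarrow> r a"
proof -
  note D = nonarchimedean_absD[OF v]
  define i where "i = Inf (range r)"
  have bdd: "bdd_below (range r)" using r0 by (meson bdd_belowI2)
  have ile: "i \<le> r a" for a unfolding i_def using bdd by (intro cInf_lower) auto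
  define \<delta> where "\<delta> n = 1 / real (Suc n)" for n
  have \<delta>: "\<delta> n > 0" for n by (simp add: \<delta>_def)
  have \<delta>lim: "\<delta> \<longlonglongrightarrow> 0" unfolding \<delta>_def using LIMSEQ_inverse_real_of_nat by (simp add: inverse_eq_divide)
  have "\<exists>a x. r a < v x \<and> v x < i + \<delta> n" for n
  proof -
    obtain a where "r a < i + \<delta> n"
      using cInf_lessD[of "range r" "i + \<delta> n"] \<delta>[of n] unfolding i_def by auto
    then show ?thesis using dense[of "r a" "i + \<delta> n"] r0 by auto
  qed
  then obtain a x where ax: "\<And>n. r (a n) < v (x n)" "\<And>n. v (x n) < i + \<delta> n" by metis
  have "(\<lambda>n. v (x n + a n - b)) \<longlonglongrightarrow> r b" for b
  proof -
    have le: "v (x n + a n - b) \<le> max (r b) (i + \<delta> n)" for n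
    proof -
      have "v (x n + (a n - b)) \<le> max (v (x n)) (v (a n - b))" by (rule D(4))
      also have "\<dots> \<le> max (r b) (i + \<delta> n)" using r2[of "a n" b] ax[of n] by auto
      finally show ?thesis by (simp add: algebra_simps)
    qed
    have ge: "r b \<le> v (x n + a n - b)" if n: "i < r b \<longrightarrow> i + \<delta> n < r b" for n
    proof (cases "r b \<le> r (a n)")
      case True
      then have "v (a n - b) < v (x n)" using r2[of "a n" b] ax[of n] by simp
      then have "v (x n + (a n - b)) = v (x n)" using nonarchimedean_dominant(1)[OF v] by blast
      then show ?thesis using ax(1)[of n] True by (simp add: algebra_simps)
    next
      case False
      then have "i + \<delta> n < r b" using ile[of "a n"] n by linarith
      moreover have "v (a n - b) \<ge> r b" using r1[of b "a n"] False D(8)[of b "a n"] by auto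
      ultimately have "v (a n - b + x n) = v (a n - b)"
        using nonarchimedean_dominant(1)[OF v] ax(2)[of n] by force
      then show ?thesis using \<open>v (a n - b) \<ge> r b\<close> by (simp add: algebra_simps)
    qed
    have "eventually (\<lambda>n. i < r b \<longrightarrow> i + \<delta> n < r b) sequentially"
    proof (cases "i < r b")
      case True
      have "(\<lambda>n. i + \<delta> n) \<longlonglongrightarrow> i" using tendsto_add[OF tendsto_const \<delta>lim] by simp
      then show ?thesis using True by (auto dest: order_tendstoD(2))
    qed auto
    then have ev: "eventually (\<lambda>n. r b \<le> v (x n + a n - b)) sequentially"
      by (rule eventually_mono) (rule ge)
    have "(\<lambda>n. max (r b) (i + \<delta> n)) \<longlonglongrightarrow> max (r b) (i + 0)"
      by (intro tendsto_intros \<delta>lim)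
    moreover have "max (r b) (i + 0) = r b" using ile[of b] by simp
    ultimately have "(\<lambda>n. max (r b) (i + \<delta> n)) \<longlonglongrightarrow> r b" by simp
    then show ?thesis
      using le by (intro tendsto_sandwich[OF ev _ tendsto_const]) auto
  qed
  then show ?thesis using that[of "\<lambda>n. x n + a n"] by blast
qed

section \<open>Linear factors over the valuation ring\<close>

lemma poly_fract_poly_to_fract: "poly (fract_poly p) (to_fract a) = to_fract (poly p a)"
  by (induction p) (simp_all add: map_poly_pCons)

lemma degree_fract_poly: "degree (fract_poly p) = degree p"
  by (rule degree_map_poly) simp

lemma fract_poly_reflect: "fract_poly (reflect_poly p) = reflect_poly (fract_poly p)"
  by (rule poly_eqI) (simp add: coeff_map_poly coeff_reflect_poly degree_fract_poly)

text \<open>A polynomial over \<open>R\<close> has a root in \<open>K\<close>. A root \<open>a\<close> in \<open>R\<close> yields the factor \<open>t - a\<close>. A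
  root outside \<open>R\<close> is \<open>1 / b\<close> with \<open>b\<close> in the maximal ideal, and then \<open>b\<close> is a root of the reflected
  polynomial. This replaces Gauss's lemma.\<close>

lemma linear_factor_over_valuation_ring:
  fixes v :: "'a::idom fract \<Rightarrow> real"
  assumes v: "induced_norm v"
    and alg_closed: "\<And>p :: 'a fract poly. degree p > 0 \<Longrightarrow> \<exists>x. poly p x = 0"
    and p: "degree (p :: 'a poly) > 0"
  obtains a q where "p = [:- a, 1:] * q" "degree q < degree p"
  | b q where "v (to_fract b) < 1" "p = [:1, - b:] * q" "degree q < degree p"
proof -
  have N: "nonarchimedean_abs v" and R: "range to_fract = {x. v x \<le> 1}"
    using v unfolding induced_norm_iff by blast+
  note D = nonarchimedean_absD[OF N]
  have p0: "p \<noteq> 0" using p by auto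
  show thesis
  proof (cases "\<exists>a. poly p a = 0")
    case True
    then obtain a q where q: "p = [:- a, 1:] * q" by (auto simp: poly_eq_0_iff_dvd elim: dvdE)
    then have "q \<noteq> 0" using p0 by auto
    then have "degree p = Suc (degree q)" unfolding q by (subst degree_mult_eq) auto
    then show thesis using q that(1) by simp
  next
    case False
    then have c0: "coeff p 0 \<noteq> 0" by (metis poly_0_coeff_0)
    obtain x where x: "poly (fract_poly p) x = 0"
      using alg_closed p by (metis degree_fract_poly)
    have "x \<notin> range to_fract"
      using x False by (auto simp: poly_fract_poly_to_fract)
    then have vx: "v x > 1" using R by auto
    then have x0: "x \<noteq> 0" using D(10) by auto
    have vix: "v (inverse x) < 1"
      using D(11)[OF x0, of 1] D(5) vx by (simp add: inverse_eq_divide)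
    then obtain b where b: "inverse x = to_fract b" using R by (metis less_imp_le mem_Collect_eq rangeE)
    have "poly (reflect_poly (fract_poly p)) (inverse x) = 0"
      using x x0 by (simp add: poly_reflect_poly_nz)
    then have "poly (reflect_poly p) b = 0"
      by (simp flip: fract_poly_reflect add: b poly_fract_poly_to_fract)
    then obtain q where q: "reflect_poly p = [:- b, 1:] * q" by (auto simp: poly_eq_0_iff_dvd elim: dvdE)
    have b0: "b \<noteq> 0" using b x0 by auto
    have "p = reflect_poly ([:- b, 1:] * q)" using c0 by (simp add: q[symmetric] del: mult_pCons_left)
    also have "\<dots> = [:1, - b:] * reflect_poly q"
      using b0 by (simp add: reflect_poly_mult reflect_poly_pCons del: mult_pCons_left)
    finally have pq: "p = [:1, - b:] * reflect_poly q" .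
    then have "reflect_poly q \<noteq> 0" using p0 by auto
    then have "degree p = Suc (degree (reflect_poly q))"
      unfolding pq using b0 by (subst degree_mult_eq) auto
    then show thesis using pq that(2) vix b by simp
  qed
qed

lemma poly_induct_linear_factors [consumes 2, case_names const root pole]:
  fixes v :: "'a::idom fract \<Rightarrow> real"
  assumes v: "induced_norm v"
    and alg_closed: "\<And>p :: 'a fract poly. degree p > 0 \<Longrightarrow> \<exists>x. poly p x = 0"
    and const: "\<And>c. P [:c:]"
    and root: "\<And>a q. P q \<Longrightarrow> P ([:- a, 1:] * q)"
    and pole: "\<And>b q. v (to_fract b) < 1 \<Longrightarrow> P q \<Longrightarrow> P ([:1, - b:] * q)"
  shows "P (p :: 'a poly)"
proof (induction "degree p" arbitrary: p rule: less_induct)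
  case less
  show ?case
  proof (cases "degree p = 0")
    case True
    then show ?thesis using const by (metis degree_eq_zeroE)
  next
    case False
    then have d: "degree p > 0" by simp
    show ?thesis
      by (rule linear_factor_over_valuation_ring[OF v alg_closed d])
        (use less root pole in \<open>auto simp del: mult_pCons_left\<close>)
  qed
qed

section \<open>Points of the Berkovich line\<close>

lemma power_le_linear_imp_le_1:
  fixes x :: real
  assumes "\<And>n. x ^ n \<le> real n + 1"
  shows "x \<le> 1"
proof (rule ccontr)
  assume "\<not> x \<le> 1"
  then have x: "x > 1" by simp
  define y where "y = sqrt x"
  have y: "y > 1" "y\<^sup>2 = x" using x by (auto simp: y_def)
  obtain n :: nat where n: "real n > 2 / (y - 1)\<^sup>2" using reals_Archimedean2 by blast
  then have n0: "n > 0" using y by (cases n) (auto simp: field_simps)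
  have "1 + real n * (y - 1) \<le> y ^ n" using Bernoulli_inequality[of "y - 1" n] y by simp
  then have "real n * (y - 1) \<le> y ^ n" by simp
  then have "(real n * (y - 1))\<^sup>2 \<le> (y ^ n)\<^sup>2" using y by (intro power_mono) auto
  also have "(y ^ n)\<^sup>2 = x ^ n" by (simp flip: y(2) power_mult add: mult.commute)
  also have "\<dots> \<le> real n + 1" by (rule assms)
  also have "\<dots> \<le> real n * 2" using n0 by simp
  finally have "real n * (real n * (y - 1)\<^sup>2) \<le> real n * 2" by (simp add: power2_eq_square algebra_simps)
  then have "real n * (y - 1)\<^sup>2 \<le> 2" using n0 by simp
  then show False using n y by (simp add: field_simps)
qed

lemma multiplicative_seminorm_power:
  assumes "multiplicative_seminorm \<mu>" "\<mu> 1 = 1"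
  shows "\<mu> (p ^ n) = \<mu> p ^ n"
  using assms by (induction n) (auto simp: multiplicative_seminorm_def)

lemma berkovich_lineD:
  assumes "\<mu> \<in> berkovich_line v"
  shows "multiplicative_seminorm \<mu>" "\<mu> p \<ge> 0" "\<mu> (p * q) = \<mu> p * \<mu> q" "\<mu> (p + q) \<le> \<mu> p + \<mu> q"
    "\<mu> 0 = 0" "\<mu> [:a:] \<le> v (to_fract a)" "\<mu> 1 = 1" "\<mu> (- p) = \<mu> p"
proof -
  show m: "multiplicative_seminorm \<mu>" "\<mu> p \<ge> 0" "\<mu> (p * q) = \<mu> p * \<mu> q" "\<mu> (p + q) \<le> \<mu> p + \<mu> q"
    "\<mu> 0 = 0" "\<mu> [:a:] \<le> v (to_fract a)" for p q a
    using assms unfolding berkovich_line_def multiplicative_seminorm_def by auto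
  obtain p0 where "\<mu> p0 \<noteq> 0" using assms unfolding berkovich_line_def by auto
  then show 1: "\<mu> 1 = 1" using m(3)[of p0 1] by simp
  have "\<mu> (-1) ^ 2 = 1" using m(3)[of "-1" "-1"] 1 by (simp add: power2_eq_square)
  then have "\<mu> (-1) = 1" using m(2)[of "-1"] by (auto simp: power2_eq_1_iff)
  then show "\<mu> (- p) = \<mu> p" using m(3)[of "-1" p] by simp
qed

text \<open>Integers are elements of \<open>R\<close>, so the seminorm is at most \<open>1\<close> on them; expanding
  \<open>(p + q) ^ n\<close> and taking \<open>n\<close>-th roots gives the strong triangle inequality.\<close>

lemma berkovich_line_nonarchimedean:
  fixes v :: "'a::idom fract \<Rightarrow> real"
  assumes v: "induced_norm v" and \<mu>: "\<mu> \<in> berkovich_line v"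
  shows "\<mu> (p + q) \<le> max (\<mu> p) (\<mu> q)" "\<mu> (p - q) \<le> max (\<mu> p) (\<mu> q)"
proof -
  note M = berkovich_lineD[OF \<mu>]
  have R: "v (to_fract x) \<le> 1" for x using v unfolding induced_norm_iff by blast
  have nat: "\<mu> (of_nat k) \<le> 1" for k
    using M(6)[of "of_nat k"] R[of "of_nat k"] by (simp add: of_nat_poly)
  have sum_le: "\<mu> (sum f A) \<le> (\<Sum>x\<in>A. \<mu> (f x))" if "finite A" for A :: "nat set" and f
    using that by (induction A rule: finite_induct)
      (auto simp: M(5) intro: order_trans[OF M(4)])
  show *: "\<mu> (p + q) \<le> max (\<mu> p) (\<mu> q)" for p q
  proof (cases "max (\<mu> p) (\<mu> q) = 0")
    case True
    then show ?thesis using M(4)[of p q] M(2)[of p] M(2)[of q] by linarith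
  next
    case False
    define m where "m = max (\<mu> p) (\<mu> q)"
    have m0: "m > 0" using False M(2)[of p] unfolding m_def by linarith
    have "(\<mu> (p + q) / m) ^ n \<le> real n + 1" for n
    proof -
      have "\<mu> (p + q) ^ n = \<mu> (\<Sum>k\<le>n. of_nat (n choose k) * p ^ k * q ^ (n - k))"
        by (simp add: multiplicative_seminorm_power[OF M(1,7), symmetric] binomial_ring)
      also have "\<dots> \<le> (\<Sum>k\<le>n. \<mu> (of_nat (n choose k) * p ^ k * q ^ (n - k)))"
        by (rule sum_le) simp
      also have "\<dots> \<le> (\<Sum>k\<le>n. m ^ n)"
      proof (rule sum_mono)
        fix k assume "k \<in> {..n}"
        then have k: "k \<le> n" by simp
        have "\<mu> (of_nat (n choose k) * p ^ k * q ^ (n - k)) =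
            \<mu> (of_nat (n choose k)) * (\<mu> p ^ k * \<mu> q ^ (n - k))"
          by (simp add: M(3) multiplicative_seminorm_power[OF M(1,7)])
        also have "\<dots> \<le> 1 * (m ^ k * m ^ (n - k))"
          using nat M(2) m0 by (intro mult_mono power_mono) (auto simp: m_def)
        also have "\<dots> = m ^ n" using k by (simp flip: power_add)
        finally show "\<mu> (of_nat (n choose k) * p ^ k * q ^ (n - k)) \<le> m ^ n" .
      qed
      also have "\<dots> = (real n + 1) * m ^ n" by simp
      finally show ?thesis using m0 by (simp add: field_simps)
    qed
    then have "\<mu> (p + q) / m \<le> 1" by (rule power_le_linear_imp_le_1)
    then show ?thesis using m0 by (simp add: m_def)
  qed
  show "\<mu> (p - q) \<le> max (\<mu> p) (\<mu> q)" using *[of p "- q"] M(8)[of q] by simp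
qed

text \<open>On \<open>R\<close> a point of the line is a power \<open>\<omega> \<ge> 1\<close> of the absolute value, or its limit for
  \<open>\<omega> \<rightarrow> \<infinity>\<close>: the trivial absolute value of the residue field. Divisibility in \<open>R\<close> is comparison of
  absolute values, so \<open>\<mu>\<close> is a monotone function of \<open>v\<close>. If it vanishes at one non-zero element,
  then also at a power of each element of the maximal ideal; otherwise its logarithm is a monotone
  homomorphism between subgroups of the reals, hence linear.\<close>

lemma berkovich_line_constants:
  fixes v :: "'a::idom fract \<Rightarrow> real"
  assumes v: "induced_norm v" and \<mu>: "\<mu> \<in> berkovich_line v"
    and c: "v (to_fract c) > 0" "v (to_fract c) < 1"
  obtains \<omega> where "\<omega> \<ge> 1" "\<And>a. \<mu> [:a:] = v (to_fract a) powr \<omega>"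
  | "\<And>a. \<mu> [:a:] = (if v (to_fract a) < 1 then 0 else 1)"
proof -
  have N: "nonarchimedean_abs v" and R: "range to_fract = {x. v x \<le> 1}"
    using v unfolding induced_norm_iff by blast+
  note D = nonarchimedean_absD[OF N]
  note M = berkovich_lineD[OF \<mu>]
  define u where "u a = v (to_fract a)" for a
  define g where "g a = \<mu> [:a:]" for a
  have u: "u a \<ge> 0" "u a = 0 \<longleftrightarrow> a = 0" "u (a * b) = u a * u b" "u a \<le> 1" "u 1 = 1"
    "u (a ^ n) = u a ^ n" for a b n
  proof -
    show mult: "u (a * b) = u a * u b" for a b by (simp add: u_def D)
    show one: "u 1 = 1" by (simp add: u_def D)
    show "u (a ^ n) = u a ^ n" by (induction n) (simp_all add: mult one)
  qed (use R in \<open>auto simp: u_def D\<close>)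
  have g: "g a \<ge> 0" "g (a * b) = g a * g b" "g 1 = 1" "g a \<le> u a" "g 0 = 0" for a b
    using M(2,6,7,5) M(3)[of "[:a:]" "[:b:]"] by (auto simp: g_def u_def one_pCons mult.commute)
  have gpow: "g (a ^ n) = g a ^ n" for a n by (induction n) (simp_all add: g)
  have div: "\<exists>d. a = b * d" if "u a \<le> u b" for a b
  proof (cases "b = 0")
    case True
    then show ?thesis using that u(1,2)[of a] u(2)[of 0] by auto
  next
    case False
    then have "v (to_fract a / to_fract b) \<le> 1"
      using that D(1)[of "to_fract b"] by (simp add: D(11) u_def divide_le_eq)
    then obtain d where "to_fract a / to_fract b = to_fract d" using R by blast
    then have "to_fract a = to_fract (b * d)" using False by (simp add: field_simps)
    then show ?thesis by (auto simp only: to_fract_eq_iff)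
  qed
  have gmono: "g a \<le> g b" if ab: "u a \<le> u b" for a b
  proof -
    obtain d where d: "a = b * d" using div[OF ab] by blast
    have "g d \<le> 1" using g(4)[of d] u(4)[of d] by linarith
    then show ?thesis using d g(1)[of b] g(1)[of d] by (simp add: g(2) mult_left_le)
  qed
  have unit: "g a = 1" if "\<not> u a < 1" for a
    using gmono[of 1 a] that g(3) g(4)[of a] u(4)[of a] u(5) by linarith
  show thesis
  proof (cases "\<exists>a. a \<noteq> 0 \<and> g a = 0")
    case True
    then obtain a where a: "a \<noteq> 0" "g a = 0" by blast
    have "g b = 0" if b: "u b < 1" for b
    proof -
      have "u a > 0" using a u(1,2)[of a] by linarith
      then obtain n where "u b ^ n < u a" using real_arch_pow_inv b by blast
      then have "u (b ^ n) \<le> u a" using u(6)[of b n] by simp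
      then have "g b ^ n \<le> 0" using gmono[of "b ^ n" a] a(2) gpow by simp
      then have "g b ^ n = 0" using g(1)[of b] by (meson antisym zero_le_power)
      then show ?thesis by simp
    qed
    then show thesis using that(2) unit unfolding g_def u_def by auto
  next
    case False
    then have gpos: "g a > 0" if "a \<noteq> 0" for a using that g(1)[of a] by fastforce
    have upos: "u a > 0" if "a \<noteq> 0" for a using that u(1,2)[of a] by fastforce
    have c': "u c > 0" "u c < 1" "c \<noteq> 0" using c u(2)[of c] by (auto simp: u_def)
    have lnc: "ln (u c) < 0" "ln (g c) \<le> ln (u c)"
      using c' gpos[of c] g(4)[of c] by auto
    define \<omega> where "\<omega> = ln (g c) / ln (u c)"
    have "\<omega> \<ge> 1" using lnc by (simp add: \<omega>_def field_simps)
    have main: "ln (g b) = ln (u b) * \<omega>" if b: "b \<noteq> 0" "u b < 1" for b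
    proof -
      have ub: "u b > 0" and gb: "g b > 0" "g b \<le> u b" using b upos gpos g(4) by auto
      define x where "x = ln (u b) / ln (u c)"
      define y where "y = ln (g b) / ln (g c)"
      have "ln (u b) < 0" using ub b by simp
      have lngc: "ln (g c) < 0" using lnc by linarith
      have "ln (g b) < 0" using gb b by simp
      have x0: "x > 0" using \<open>ln (u b) < 0\<close> lnc by (simp add: x_def divide_neg_neg)
      have y0: "y > 0" using \<open>ln (g b) < 0\<close> lngc by (simp add: y_def divide_neg_neg)
      have cmp: "ln (u d) \<le> ln (u e) \<Longrightarrow> ln (g d) \<le> ln (g e)" if "d \<noteq> 0" "e \<noteq> 0" for d e
        using gmono[of d e] upos gpos that by simp
      have lnpow: "ln (u (d ^ n)) = real n * ln (u d)" "ln (g (d ^ n)) = real n * ln (g d)"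
        if "d \<noteq> 0" for d n
        using that upos gpos by (simp_all add: u(6) gpow ln_realpow)
      \<comment> \<open>comparing \<open>b ^ m\<close> with \<open>c ^ n\<close> shows that \<open>x\<close> and \<open>y\<close> lie on the same side of every
         positive fraction \<open>n / m\<close>\<close>
      have up: "real n \<le> real m * y" if "real n \<le> real m * x" for m n
      proof -
        have "ln (u (b ^ m)) \<le> ln (u (c ^ n))"
          using that lnc b c' by (simp add: lnpow x_def field_simps)
        then have "ln (g (b ^ m)) \<le> ln (g (c ^ n))" using b c' by (intro cmp) auto
        then show ?thesis using lngc b c' by (simp add: lnpow y_def field_simps)
      qed
      have down: "real m * y \<le> real n" if "real m * x \<le> real n" for m n
      proof -
        have "ln (u (c ^ n)) \<le> ln (u (b ^ m))"
          using that lnc b c' by (simp add: lnpow x_def field_simps)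
        then have "ln (g (c ^ n)) \<le> ln (g (b ^ m))" using b c' by (intro cmp) auto
        then show ?thesis using lngc b c' by (simp add: lnpow y_def field_simps)
      qed
      have ratio: "\<exists>m n. s < real n / real m \<and> real n / real m < t \<and> m > 0"
        if st: "0 < s" "s < t" for s t :: real
      proof -
        obtain q where q: "s < of_rat q" "of_rat q < t" using of_rat_dense st by blast
        obtain i j where ij: "quotient_of q = (i, j)" by (cases "quotient_of q") auto
        then have "j > 0" by (rule quotient_of_denom_pos)
        have qij: "(of_rat q :: real) = real_of_int i / real_of_int j"
          using quotient_of_div[OF ij] by (simp add: of_rat_divide)
        have "0 < real_of_int i / real_of_int j" using q st unfolding qij by linarith
        then have "i > 0" using \<open>j > 0\<close> by (simp add: zero_less_divide_iff)
        then show ?thesis using q \<open>j > 0\<close> unfolding qij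
          by (intro exI[of _ "nat j"] exI[of _ "nat i"]) auto
      qed
      have "x = y"
      proof (rule linorder_cases[of x y])
        assume "x < y"
        then obtain m n where mn: "x < real n / real m" "real n / real m < y" "m > 0"
          using ratio x0 by blast
        then have "real m * x \<le> real n" "real n < real m * y" by (auto simp: field_simps)
        then show ?thesis using down by force
      next
        assume "y < x"
        then obtain m n where mn: "y < real n / real m" "real n / real m < x" "m > 0"
          using ratio y0 by blast
        then have "real n \<le> real m * x" "real m * y < real n" by (auto simp: field_simps)
        then show ?thesis using up by force
      qed auto
      then show ?thesis using lnc lngc by (simp add: x_def y_def \<omega>_def field_simps)
    qed
    have "g a = u a powr \<omega>" for a
    proof -
      consider "a = 0" | "u a = 1" | "a \<noteq> 0" "u a < 1" using u(4)[of a] by linarith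
      then show ?thesis
      proof cases
        case 1
        then show ?thesis using g(5) u(2)[of 0] by simp
      next
        case 2
        then show ?thesis using unit by simp
      next
        case 3
        then show ?thesis using main[OF 3] upos[of a] gpos[of a]
          by (simp add: powr_def) (metis exp_ln mult.commute)
      qed
    qed
    then show thesis using that(1) \<open>\<omega> \<ge> 1\<close> unfolding g_def u_def by auto
  qed
qed

lemma evaluation_in_berkovich_line:
  fixes v :: "'a::idom fract \<Rightarrow> real"
  assumes v: "induced_norm v" and \<omega>: "\<omega> > 1"
  shows "evaluation_seminorm v (s, \<omega>) \<in> berkovich_line v"
proof -
  have N: "nonarchimedean_abs v" and R: "range to_fract = {x. v x \<le> 1}"
    using v unfolding induced_norm_iff by blast+
  note D = nonarchimedean_absD[OF N]
  let ?e = "evaluation_seminorm v (s, \<omega>)"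
  have "?e (p + q) \<le> ?e p + ?e q" for p q
  proof -
    define x y where "x = poly (fract_poly p) s" and "y = poly (fract_poly q) s"
    have "v (x + y) \<le> v x \<or> v (x + y) \<le> v y" using D(4)[of x y] by (simp add: max_def split: if_splits)
    then have "v (x + y) powr \<omega> \<le> v x powr \<omega> \<or> v (x + y) powr \<omega> \<le> v y powr \<omega>"
      using \<omega> D(1) by (auto intro: powr_mono2)
    then have "v (x + y) powr \<omega> \<le> v x powr \<omega> + v y powr \<omega>"
      using powr_ge_zero[of "v x" \<omega>] powr_ge_zero[of "v y" \<omega>] by linarith
    then show ?thesis by (simp add: evaluation_seminorm_def x_def y_def)
  qed
  then have "multiplicative_seminorm ?e"
    unfolding multiplicative_seminorm_def
    by (auto simp: evaluation_seminorm_def D powr_mult)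
  moreover have "?e 1 \<noteq> 0" by (simp add: evaluation_seminorm_def D)
  moreover have "?e [:a:] \<le> v (to_fract a)" for a
  proof -
    have "v (to_fract a) \<le> 1" using R by blast
    then have "v (to_fract a) powr \<omega> \<le> v (to_fract a) powr 1"
      using \<omega> D(1) by (intro powr_mono') auto
    then show ?thesis using D(1) by (simp add: evaluation_seminorm_def map_poly_pCons)
  qed
  ultimately show ?thesis unfolding berkovich_line_def by blast
qed

section \<open>Approximation by evaluations\<close>

lemma evaluation_tendsto_of_linear_factors:
  fixes v :: "'a::idom fract \<Rightarrow> real" and \<omega> :: "nat \<Rightarrow> real"
  assumes v: "induced_norm v"
    and alg_closed: "\<And>p :: 'a fract poly. degree p > 0 \<Longrightarrow> \<exists>x. poly p x = 0"
    and \<mu>: "\<mu> \<in> berkovich_line v"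
    and \<omega>: "\<And>n. \<omega> n > 1"
    and const: "\<And>c. (\<lambda>n. v (to_fract c) powr \<omega> n) \<longlonglongrightarrow> \<mu> [:c:]"
    and root: "\<And>a. (\<lambda>n. v (s n - to_fract a) powr \<omega> n) \<longlonglongrightarrow> \<mu> [:- a, 1:]"
    and pole: "\<And>b. v (to_fract b) < 1 \<Longrightarrow>
      (\<lambda>n. v (1 - to_fract b * s n) powr \<omega> n) \<longlonglongrightarrow> \<mu> [:1, - b:]"
  shows "(\<lambda>n. evaluation_seminorm v (s n, \<omega> n) p) \<longlonglongrightarrow> \<mu> p"
proof (induction p rule: poly_induct_linear_factors[OF v alg_closed])
  case (2 c)
  then show ?case using const[of c] by (simp add: evaluation_seminorm_def map_poly_pCons)
next
  case (3 a q)
  have "(\<lambda>n. evaluation_seminorm v (s n, \<omega> n) [:- a, 1:]) \<longlonglongrightarrow> \<mu> [:- a, 1:]"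
    using root[of a] by (simp add: evaluation_seminorm_def map_poly_pCons)
  then show ?case
    unfolding berkovich_lineD(3)[OF \<mu>] berkovich_lineD(3)[OF evaluation_in_berkovich_line[OF v \<omega>]]
    using 3 by (rule tendsto_mult)
next
  case (4 b q)
  have "(\<lambda>n. evaluation_seminorm v (s n, \<omega> n) [:1, - b:]) \<longlonglongrightarrow> \<mu> [:1, - b:]"
    using pole[of b] 4 by (simp add: evaluation_seminorm_def map_poly_pCons mult.commute)
  then show ?case
    unfolding berkovich_lineD(3)[OF \<mu>] berkovich_lineD(3)[OF evaluation_in_berkovich_line[OF v \<omega>]]
    using 4(2) by (rule tendsto_mult)
qed

text \<open>If \<open>\<mu>\<close> is the power \<open>\<omega>\<close> of the absolute value on \<open>R\<close>, then \<open>\<mu> powr (1 / \<omega>)\<close> extends to the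
  polynomials over \<open>K\<close>, and \<open>r a\<close> below is the value of \<open>t - a\<close> under this extension. The exponents
  \<open>\<omega> + 1 / (n + 1)\<close> stay above \<open>1\<close> even if \<open>\<omega> = 1\<close>.\<close>

lemma berkovich_line_limit_finite_exponent:
  fixes v :: "'a::idom fract \<Rightarrow> real"
  assumes v: "induced_norm v"
    and alg_closed: "\<And>p :: 'a fract poly. degree p > 0 \<Longrightarrow> \<exists>x. poly p x = 0"
    and dense: "\<And>lo hi. 0 \<le> lo \<Longrightarrow> lo < hi \<Longrightarrow> \<exists>x. lo < v x \<and> v x < hi"
    and \<mu>: "\<mu> \<in> berkovich_line v"
    and \<omega>: "\<omega> \<ge> 1" and const: "\<And>a. \<mu> [:a:] = v (to_fract a) powr \<omega>"
  obtains s \<omega>s where "\<And>n. \<omega>s n > (1::real)"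
    "\<And>p. (\<lambda>n. evaluation_seminorm v (s n, \<omega>s n) p) \<longlonglongrightarrow> \<mu> p"
proof -
  have N: "nonarchimedean_abs v" and R: "range to_fract = {x. v x \<le> 1}"
    using v unfolding induced_norm_iff by blast+
  note D = nonarchimedean_absD[OF N]
  note M = berkovich_lineD[OF \<mu>]
  define L where "L p = \<mu> p powr (1 / \<omega>)" for p
  have L0: "L p \<ge> 0" for p by (simp add: L_def)
  have Lc: "L [:a:] = v (to_fract a)" for a
    using \<omega> D(1) by (simp add: L_def const powr_powr)
  have Lmult: "L (p * q) = L p * L q" for p q by (simp add: L_def M powr_mult)
  have Ldiff: "L (p - q) \<le> max (L p) (L q)" for p q
  proof -
    have "\<mu> (p - q) \<le> \<mu> p \<or> \<mu> (p - q) \<le> \<mu> q"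
      using berkovich_line_nonarchimedean(2)[OF v \<mu>, of p q] by (simp add: max_def split: if_splits)
    then have "L (p - q) \<le> L p \<or> L (p - q) \<le> L q"
      unfolding L_def using \<omega> M(2) by (auto intro: powr_mono2)
    then show ?thesis by auto
  qed
  have "\<exists>z. snd z \<noteq> 0 \<and> a = to_fract (fst z) / to_fract (snd z)" for a :: "'a fract"
    by (cases a) (auto simp: Fract_conv_to_fract)
  then have "\<forall>a :: 'a fract. \<exists>z. snd z \<noteq> 0 \<and> a = to_fract (fst z) / to_fract (snd z)" by blast
  from choice[OF this] obtain frac :: "'a fract \<Rightarrow> 'a \<times> 'a"
    where frac: "\<forall>a. snd (frac a) \<noteq> 0 \<and> a = to_fract (fst (frac a)) / to_fract (snd (frac a))"
    by blast
  define num where "num a = fst (frac a)" for a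
  define den where "den a = snd (frac a)" for a
  have nd: "den a \<noteq> 0" "a = to_fract (num a) / to_fract (den a)" for a
    using frac unfolding num_def den_def by blast+
  define r where "r a = L [:- num a, den a:] / v (to_fract (den a))" for a
  have vpos: "v (to_fract y) > 0" if "y \<noteq> 0" for y
    using D(1)[of "to_fract y"] D(2)[of "to_fract y"] that by auto
  have r: "L [:- x, y:] = v (to_fract y) * r a" if y: "y \<noteq> 0" and a: "a * to_fract y = to_fract x" for x y a
  proof -
    have "to_fract (num a) = a * to_fract (den a)" using nd[of a] by (simp add: field_simps)
    then have "to_fract (x * den a) = to_fract (num a * y)" by (simp flip: a)
    then have "x * den a = num a * y" by (simp only: to_fract_eq_iff)
    then have "[:den a:] * [:- x, y:] = [:y:] * [:- num a, den a:]" by (simp add: mult.commute)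
    then have "L ([:den a:] * [:- x, y:]) = L ([:y:] * [:- num a, den a:])" by (rule arg_cong)
    then have "v (to_fract (den a)) * L [:- x, y:] = v (to_fract y) * L [:- num a, den a:]"
      by (simp only: Lmult Lc)
    then show ?thesis using vpos[OF nd(1)[of a]] by (simp add: r_def field_simps)
  qed
  have common: "\<exists>x x' y. y \<noteq> 0 \<and> a * to_fract y = to_fract x \<and> b * to_fract y = to_fract x'"
    for a b :: "'a fract"
  proof -
    have "a * to_fract (den a * den b) = to_fract (num a * den b)"
      using nd(1)[of a] by (subst nd(2)[of a]) simp
    moreover have "b * to_fract (den a * den b) = to_fract (num b * den a)"
      using nd(1)[of b] by (subst nd(2)[of b]) simp
    ultimately show ?thesis using nd(1) by (metis mult_eq_0_iff)
  qed
  have max_mult: "max (c * x) (c * y) = c * max x y" if "c > 0" for c x y :: real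
    using that by (simp add: max_def)
  have r1: "r a \<le> max (r b) (v (a - b))" and r2: "v (a - b) \<le> max (r a) (r b)" for a b
  proof -
    obtain x x' y where xy: "y \<noteq> 0" "a * to_fract y = to_fract x" "b * to_fract y = to_fract x'"
      using common by blast
    have ra: "L [:- x, y:] = v (to_fract y) * r a" and rb: "L [:- x', y:] = v (to_fract y) * r b"
      using r xy by auto
    have "(a - b) * to_fract y = to_fract (x - x')" using xy by (simp add: algebra_simps)
    then have d: "L [:x - x':] = v (to_fract y) * v (a - b)" by (simp add: Lc mult.commute flip: D(3))
    have "L [:- x, y:] \<le> max (L [:- x', y:]) (L [:x - x':])"
      using Ldiff[of "[:- x', y:]" "[:x - x':]"] by simp
    then show "r a \<le> max (r b) (v (a - b))"
      unfolding ra rb d max_mult[OF vpos[OF xy(1)]] using vpos[OF xy(1)] by simp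
    have "L [:x - x':] \<le> max (L [:- x', y:]) (L [:- x, y:])"
      using Ldiff[of "[:- x', y:]" "[:- x, y:]"] by simp
    then show "v (a - b) \<le> max (r a) (r b)"
      unfolding ra rb d max_mult[OF vpos[OF xy(1)]] using vpos[OF xy(1)] by (simp add: max.commute)
  qed
  have r0: "r a \<ge> 0" for a using L0 D(1) by (simp add: r_def)
  obtain s where s: "\<And>a. (\<lambda>n. v (s n - a)) \<longlonglongrightarrow> r a"
    using disc_function_limit[OF N dense r0 r1 r2] by blast
  define \<omega>s where "\<omega>s n = \<omega> + 1 / real (Suc n)" for n
  have \<omega>s1: "\<omega>s n > 1" for n
  proof -
    have "1 / real (Suc n) > 0" by simp
    then show ?thesis using \<omega> unfolding \<omega>s_def by linarith
  qed
  have \<omega>slim: "\<omega>s \<longlonglongrightarrow> \<omega>"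
    using tendsto_add[OF tendsto_const[of \<omega>] LIMSEQ_inverse_real_of_nat]
    by (simp add: \<omega>s_def[abs_def] inverse_eq_divide)
  have \<mu>L: "\<mu> p = L p powr \<omega>" for p using \<omega> M(2) by (simp add: L_def powr_powr)
  have lin: "(\<lambda>n. v (to_fract y * s n - to_fract x) powr \<omega>s n) \<longlonglongrightarrow> \<mu> [:- x, y:]" for x y
  proof -
    have "(\<lambda>n. v (to_fract y * s n - to_fract x)) \<longlonglongrightarrow> L [:- x, y:]"
    proof (cases "y = 0")
      case True
      then show ?thesis using Lc[of "- x"] by (simp add: D)
    next
      case False
      define a where "a = to_fract x / to_fract y"
      have "v (to_fract y * s n - to_fract x) = v (to_fract y) * v (s n - a)" for n
        using False by (simp flip: D(3) add: a_def right_diff_distrib)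
      moreover have "L [:- x, y:] = v (to_fract y) * r a"
        using False by (intro r) (auto simp: a_def)
      ultimately show ?thesis using s[of a] by (simp add: tendsto_mult_left)
    qed
    then show ?thesis
      unfolding \<mu>L using \<omega>slim \<omega> D(1) by (intro tendsto_powr') auto
  qed
  have "(\<lambda>n. evaluation_seminorm v (s n, \<omega>s n) p) \<longlonglongrightarrow> \<mu> p" for p
  proof (rule evaluation_tendsto_of_linear_factors[OF v alg_closed \<mu> \<omega>s1])
    show "(\<lambda>n. v (to_fract c) powr \<omega>s n) \<longlonglongrightarrow> \<mu> [:c:]" for c
      using lin[of 0 "- c"] by simp
    show "(\<lambda>n. v (s n - to_fract a) powr \<omega>s n) \<longlonglongrightarrow> \<mu> [:- a, 1:]" for a
      using lin[of 1 a] by simp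
    show "(\<lambda>n. v (1 - to_fract b * s n) powr \<omega>s n) \<longlonglongrightarrow> \<mu> [:1, - b:]" for b
      using lin[of "- b" "- 1"] by simp
  qed auto
  then show ?thesis using that \<omega>s1 by blast
qed

text \<open>If \<open>\<mu>\<close> is trivial on \<open>R\<close>, it is a point of the affine line over the residue field with the
  trivial absolute value: either all the \<open>t - a\<close> have the same value, at least \<open>1\<close>, or some
  \<open>t - a\<^sub>0\<close> has a value below \<open>1\<close>, shared by all \<open>t - a\<close> with \<open>a\<close> congruent to \<open>a\<^sub>0\<close>. In both
  cases the exponents tend to infinity, and the absolute values of the approximating points, or
  their distances from \<open>a\<^sub>0\<close>, are chosen so that their powers tend to the right value.\<close>

lemma berkovich_line_limit_infinite_exponent:
  fixes v :: "'a::idom fract \<Rightarrow> real"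
  assumes v: "induced_norm v"
    and alg_closed: "\<And>p :: 'a fract poly. degree p > 0 \<Longrightarrow> \<exists>x. poly p x = 0"
    and dense: "\<And>lo hi. 0 \<le> lo \<Longrightarrow> lo < hi \<Longrightarrow> \<exists>x. lo < v x \<and> v x < hi"
    and \<mu>: "\<mu> \<in> berkovich_line v"
    and const: "\<And>a. \<mu> [:a:] = (if v (to_fract a) < 1 then 0 else 1)"
  obtains s \<omega> where "\<And>n. \<omega> n > (1::real)"
    "\<And>p. (\<lambda>n. evaluation_seminorm v (s n, \<omega> n) p) \<longlonglongrightarrow> \<mu> p"
proof -
  have N: "nonarchimedean_abs v" and R: "range to_fract = {x. v x \<le> 1}"
    using v unfolding induced_norm_iff by blast+
  note D = nonarchimedean_absD[OF N]
  note M = berkovich_lineD[OF \<mu>]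
  note U = berkovich_line_nonarchimedean[OF v \<mu>]
  have R1: "v (to_fract a) \<le> 1" for a using R by blast
  define \<omega> where "\<omega> n = real (n + 2)" for n
  have \<omega>1: "\<omega> n > 1" for n by (simp add: \<omega>_def)
  have dense_powr: "\<exists>x. lo < v x powr \<omega> n \<and> v x powr \<omega> n < hi" if lh: "0 \<le> lo" "lo < hi" for lo hi n
  proof -
    have w: "\<omega> n > 0" using \<omega>1[of n] by simp
    then have "lo powr (1 / \<omega> n) < hi powr (1 / \<omega> n)" using lh by (intro powr_less_mono2) auto
    then obtain x where "lo powr (1 / \<omega> n) < v x" "v x < hi powr (1 / \<omega> n)"
      using dense by (meson powr_ge_zero)
    then have "(lo powr (1 / \<omega> n)) powr \<omega> n < v x powr \<omega> n"
        "v x powr \<omega> n < (hi powr (1 / \<omega> n)) powr \<omega> n"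
      using w D(1) by (auto intro!: powr_less_mono2)
    then show ?thesis using w lh by (auto simp: powr_powr)
  qed
  have pow0: "(\<lambda>n. q powr \<omega> n) \<longlonglongrightarrow> 0" if q: "0 \<le> q" "q < 1" for q :: real
  proof (cases "q = 0")
    case False
    then have "q powr \<omega> n = q ^ (n + 2)" for n using q unfolding \<omega>_def by (subst powr_realpow) auto
    then show ?thesis using LIMSEQ_ignore_initial_segment[OF LIMSEQ_realpow_zero[OF q], of 2] by simp
  qed simp
  have lt1: "v x < 1" if "v x powr \<omega> n < 1" for x n
  proof (rule ccontr)
    assume "\<not> v x < 1"
    then have "1 powr \<omega> n \<le> v x powr \<omega> n" using \<omega>1[of n] by (intro powr_mono2) auto
    then show False using that by simp
  qed
  have gt1: "v x > 1" if "v x powr \<omega> n > 1" for x n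
  proof (rule ccontr)
    assume "\<not> v x > 1"
    then have "v x powr \<omega> n \<le> 1 powr \<omega> n" using \<omega>1[of n] D(1) by (intro powr_mono2) auto
    then show False using that by simp
  qed
  define \<delta> where "\<delta> n = 1 / real (Suc n)" for n
  have \<delta>: "\<delta> n > 0" "\<delta> n \<le> 1" for n by (auto simp: \<delta>_def)
  have \<delta>lim: "\<delta> \<longlonglongrightarrow> 0"
    unfolding \<delta>_def using LIMSEQ_inverse_real_of_nat by (simp add: inverse_eq_divide)
  have squeeze: "f \<longlonglongrightarrow> r" if "\<And>n. r < f n \<and> f n < r + \<delta> n" for f :: "nat \<Rightarrow> real" and r
  proof (rule tendsto_sandwich[OF _ _ tendsto_const])
    show "(\<lambda>n. r + \<delta> n) \<longlonglongrightarrow> r" using tendsto_add[OF tendsto_const \<delta>lim] by simp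
  qed (use that in \<open>auto intro!: always_eventually less_imp_le\<close>)
  have const_lim: "(\<lambda>n. v (to_fract c) powr \<omega> n) \<longlonglongrightarrow> \<mu> [:c:]" for c
  proof (cases "v (to_fract c) < 1")
    case True
    then show ?thesis using pow0 D(1) by (simp add: const)
  next
    case False
    then have "v (to_fract c) = 1" using R1[of c] by simp
    then show ?thesis by (simp add: const)
  qed
  have pole_lim: "(\<lambda>n. v (1 - to_fract b * s n) powr \<omega> n) \<longlonglongrightarrow> \<mu> [:1, - b:]"
    if b: "v (to_fract b) < 1" and ev: "eventually (\<lambda>n. v (to_fract b * s n) < 1) sequentially" for b s
  proof -
    define q where "q = [:b:] * [:0, 1:]"
    have "\<mu> q = 0" unfolding q_def M(3) using b by (simp add: const)
    then have "\<mu> (1 - q) = 1"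
      using U(2)[of 1 q] U(1)[of "1 - q" q] M(7) M(2)[of "1 - q"] by simp
    moreover have "[:1, - b:] = 1 - q" by (simp add: q_def one_pCons)
    ultimately have "\<mu> [:1, - b:] = 1" by simp
    moreover have "eventually (\<lambda>n. v (1 - to_fract b * s n) powr \<omega> n = 1) sequentially"
      using ev by eventually_elim (simp add: nonarchimedean_dominant[OF N] D(5))
    ultimately show ?thesis by (simp add: tendsto_eventually)
  qed
  note evaluation_lim = evaluation_tendsto_of_linear_factors[OF v alg_closed \<mu> \<omega>1 const_lim]
  show thesis
  proof (cases "\<exists>a. \<mu> [:- a, 1:] < 1")
    case False
    define r where "r = \<mu> [:0, 1:]"
    have r1: "r \<ge> 1" using False[unfolded not_ex, rule_format, of 0] by (simp add: r_def)
    have r: "\<mu> [:- a, 1:] = r" for a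
    proof -
      have "\<mu> [:a:] \<le> 1" by (simp add: const)
      moreover have "\<mu> [:- a, 1:] \<ge> 1" using False by (meson not_less)
      moreover have "\<mu> [:- a, 1:] \<le> max r (\<mu> [:a:])" using U(2)[of "[:0, 1:]" "[:a:]"] by (simp add: r_def)
      moreover have "r \<le> max (\<mu> [:- a, 1:]) (\<mu> [:a:])" using U(1)[of "[:- a, 1:]" "[:a:]"] by (simp add: r_def)
      ultimately show ?thesis using r1 by linarith
    qed
    have "\<exists>x. r < v x powr \<omega> n \<and> v x powr \<omega> n < r + \<delta> n" for n
      using r1 \<delta>(1)[of n] by (intro dense_powr) auto
    then obtain s where s: "\<And>n. r < v (s n) powr \<omega> n \<and> v (s n) powr \<omega> n < r + \<delta> n" by metis
    have s1: "v (s n) > 1" for n using s[of n] r1 by (intro gt1[of _ n]) auto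
    have "(\<lambda>n. evaluation_seminorm v (s n, \<omega> n) p) \<longlonglongrightarrow> \<mu> p" for p
    proof (rule evaluation_lim)
      fix a
      have "v (s n - to_fract a) = v (s n)" for n
        using nonarchimedean_dominant(2)[OF N] s1[of n] R1[of a] by force
      then show "(\<lambda>n. v (s n - to_fract a) powr \<omega> n) \<longlonglongrightarrow> \<mu> [:- a, 1:]"
        using squeeze[OF s] by (simp add: r)
    next
      fix b assume b: "v (to_fract b) < 1"
      have "(\<lambda>n. v (to_fract b) powr \<omega> n * (r + 1)) \<longlonglongrightarrow> 0"
        using tendsto_mult_right[OF pow0[OF D(1) b], of "r + 1"] by simp
      then have "eventually (\<lambda>n. v (to_fract b) powr \<omega> n * (r + 1) < 1) sequentially"
        by (rule order_tendstoD) simp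
      then have "eventually (\<lambda>n. v (to_fract b * s n) < 1) sequentially"
      proof eventually_elim
        case (elim n)
        have "v (s n) powr \<omega> n \<le> r + 1" using s[of n] \<delta>(2)[of n] by linarith
        then have "v (to_fract b) powr \<omega> n * v (s n) powr \<omega> n \<le> v (to_fract b) powr \<omega> n * (r + 1)"
          by (intro mult_left_mono) auto
        then have "v (to_fract b * s n) powr \<omega> n < 1" using elim by (simp add: D(3) powr_mult)
        then show ?case by (rule lt1)
      qed
      then show "(\<lambda>n. v (1 - to_fract b * s n) powr \<omega> n) \<longlonglongrightarrow> \<mu> [:1, - b:]"
        by (rule pole_lim[OF b])
    qed auto
    then show thesis using that \<omega>1 by blast
  next
    case True
    then obtain a0 where a0: "\<mu> [:- a0, 1:] < 1" by blast
    define r where "r = \<mu> [:- a0, 1:]"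
    have r: "0 \<le> r" "r < 1" using a0 M(2) by (auto simp: r_def)
    have "\<exists>x. r < v x powr \<omega> n \<and> v x powr \<omega> n < min 1 (r + \<delta> n)" for n
      using r \<delta>(1)[of n] by (intro dense_powr) auto
    then obtain x where x': "\<And>n. r < v (x n) powr \<omega> n \<and> v (x n) powr \<omega> n < min 1 (r + \<delta> n)" by metis
    then have x: "r < v (x n) powr \<omega> n \<and> v (x n) powr \<omega> n < r + \<delta> n" for n by simp
    have x1: "v (x n) < 1" for n using x'[of n] by (intro lt1[of _ n]) auto
    define s where "s n = to_fract a0 + x n" for n
    have "(\<lambda>n. evaluation_seminorm v (s n, \<omega> n) p) \<longlonglongrightarrow> \<mu> p" for p
    proof (rule evaluation_lim)
      fix a
      define d where "d = a0 - a"
      have sa: "s n - to_fract a = to_fract d + x n" for n by (simp add: s_def d_def)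
      have t: "[:- a, 1:] = [:- a0, 1:] + [:d:]" "[:- a0, 1:] = [:- a, 1:] - [:d:]"
        by (simp_all add: d_def)
      have le: "\<mu> [:- a, 1:] \<le> max r (\<mu> [:d:])" "r \<le> max (\<mu> [:- a, 1:]) (\<mu> [:d:])"
          "\<mu> [:d:] \<le> max (\<mu> [:- a, 1:]) r"
        using U(1)[of "[:- a0, 1:]" "[:d:]"] U(2)[of "[:- a, 1:]" "[:d:]"]
          U(2)[of "[:- a, 1:]" "[:- a0, 1:]"] by (simp_all add: d_def r_def)
      show "(\<lambda>n. v (s n - to_fract a) powr \<omega> n) \<longlonglongrightarrow> \<mu> [:- a, 1:]"
      proof (cases "v (to_fract d) < 1")
        case False
        then have d: "v (to_fract d) = 1" using R1[of d] by simp
        then have "\<mu> [:d:] = 1" by (simp add: const)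
        then have "\<mu> [:- a, 1:] = 1" using le r by simp
        moreover have "v (to_fract d + x n) = 1" for n
          using nonarchimedean_dominant(1)[OF N, of "x n" "to_fract d"] x1[of n] d by simp
        ultimately show ?thesis by (simp add: sa)
      next
        case d: True
        then have "\<mu> [:d:] = 0" by (simp add: const)
        then have \<mu>a: "\<mu> [:- a, 1:] = r" using le r M(2)[of "[:- a, 1:]"] by simp
        have upper: "v (to_fract d + x n) powr \<omega> n \<le> max (v (to_fract d) powr \<omega> n) (v (x n) powr \<omega> n)" for n
        proof -
          have "v (to_fract d + x n) \<le> v (to_fract d) \<or> v (to_fract d + x n) \<le> v (x n)"
            using D(4)[of "to_fract d" "x n"] by linarith
          then have "v (to_fract d + x n) powr \<omega> n \<le> v (to_fract d) powr \<omega> n \<or>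
              v (to_fract d + x n) powr \<omega> n \<le> v (x n) powr \<omega> n"
            using \<omega>1[of n] D(1) by (auto intro: powr_mono2)
          then show ?thesis by auto
        qed
        have lower: "eventually (\<lambda>n. r \<le> v (to_fract d + x n) powr \<omega> n) sequentially"
        proof (cases "r = 0")
          case False
          then have "r > 0" using r by simp
          with pow0[OF D(1) d] have "eventually (\<lambda>n. v (to_fract d) powr \<omega> n < r) sequentially"
            by (rule order_tendstoD)
          then show ?thesis
          proof eventually_elim
            case (elim n)
            have "v (to_fract d) < v (x n)"
            proof (rule ccontr)
              assume "\<not> v (to_fract d) < v (x n)"
              then have "v (x n) powr \<omega> n \<le> v (to_fract d) powr \<omega> n"
                using \<omega>1[of n] D(1) by (intro powr_mono2) auto
              then show False using elim x[of n] by linarith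
            qed
            then have "v (x n + to_fract d) = v (x n)" by (rule nonarchimedean_dominant(1)[OF N])
            then show ?case using x[of n] by (simp add: add.commute)
          qed
        qed simp
        have "(\<lambda>n. max (v (to_fract d) powr \<omega> n) (v (x n) powr \<omega> n)) \<longlonglongrightarrow> max 0 r"
          by (intro tendsto_max pow0[OF D(1) d] squeeze[OF x])
        then have "(\<lambda>n. max (v (to_fract d) powr \<omega> n) (v (x n) powr \<omega> n)) \<longlonglongrightarrow> r"
          using r by simp
        then show ?thesis
          unfolding sa \<mu>a
          by (intro tendsto_sandwich[OF lower _ tendsto_const]) (auto simp: upper)
      qed
    next
      fix b assume b: "v (to_fract b) < 1"
      have "v (to_fract b * s n) < 1" for n
      proof -
        have "v (s n) \<le> 1" using D(4)[of "to_fract a0" "x n"] R1[of a0] x1[of n] unfolding s_def by linarith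
        then have "v (to_fract b) * v (s n) \<le> v (to_fract b) * 1" using D(1) by (intro mult_left_mono) auto
        then show ?thesis using b by (simp add: D(3))
      qed
      then show "(\<lambda>n. v (1 - to_fract b * s n) powr \<omega> n) \<longlonglongrightarrow> \<mu> [:1, - b:]"
        by (intro pole_lim[OF b]) simp
    qed auto
    then show thesis using that \<omega>1 by blast
  qed
qed

section \<open>The uniform structure of the Berkovich line\<close>

lemma uniform_structure_pullback:
  assumes V: "uniform_structure T V" and i: "i ` S \<subseteq> T"
  shows "uniform_structure S (inf (filtercomap (map_prod i i) V) (principal (S \<times> S)))"
    (is "uniform_structure S ?U")
proof -
  have ev: "eventually E ?U \<longleftrightarrow>
      (\<exists>D. eventually D V \<and> (\<forall>x\<in>S. \<forall>y\<in>S. D (i x, i y) \<longrightarrow> E (x, y)))" for E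
    unfolding eventually_inf_principal eventually_filtercomap
  proof safe
    fix D assume "eventually D V" "\<forall>z. D (map_prod i i z) \<longrightarrow> z \<in> S \<times> S \<longrightarrow> E z"
    then show "\<exists>D. eventually D V \<and> (\<forall>x\<in>S. \<forall>y\<in>S. D (i x, i y) \<longrightarrow> E (x, y))"
      by (intro exI[of _ D]) simp
  next
    fix D assume "eventually D V" "\<forall>x\<in>S. \<forall>y\<in>S. D (i x, i y) \<longrightarrow> E (x, y)"
    then show "\<exists>D. eventually D V \<and> (\<forall>z. D (map_prod i i z) \<longrightarrow> z \<in> S \<times> S \<longrightarrow> E z)"
      by (intro exI[of _ D]) simp
  qed
  have refl: "D (i x, i x)" if "eventually D V" "x \<in> S" for D x
  proof -
    have "i x \<in> T" using i that(2) by blast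
    moreover have "\<forall>E. eventually E V \<longrightarrow> (\<forall>x\<in>T. E (x, x))"
      using V unfolding uniform_structure_def by (elim conjE)
    ultimately show ?thesis using that(1) by blast
  qed
  have sym: "eventually (\<lambda>(x, y). D (y, x)) V" if "eventually D V" for D
    using V that unfolding uniform_structure_def by simp
  have comp: "\<exists>D'. eventually D' V \<and> (\<forall>x y z. D' (x, y) \<longrightarrow> D' (y, z) \<longrightarrow> D (x, z))"
    if "eventually D V" for D
    using V that unfolding uniform_structure_def by simp
  show ?thesis
    unfolding uniform_structure_def
  proof (intro conjI allI impI ballI)
    show "?U \<le> principal (S \<times> S)" by simp
  next
    fix E x assume "eventually E ?U" "x \<in> S"
    then obtain D where "eventually D V" "D (i x, i x) \<longrightarrow> E (x, x)" unfolding ev by blast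
    then show "E (x, x)" using refl[of D x] \<open>x \<in> S\<close> by simp
  next
    fix E assume "eventually E ?U"
    then obtain D where D: "eventually D V" "\<forall>x\<in>S. \<forall>y\<in>S. D (i x, i y) \<longrightarrow> E (x, y)"
      unfolding ev by blast
    then show "eventually (\<lambda>(x, y). E (y, x)) ?U"
      unfolding ev using sym[OF D(1)] by (intro exI[of _ "\<lambda>(x, y). D (y, x)"]) simp
  next
    fix E assume "eventually E ?U"
    then obtain D where D: "eventually D V" "\<And>x y. x \<in> S \<Longrightarrow> y \<in> S \<Longrightarrow> D (i x, i y) \<Longrightarrow> E (x, y)"
      unfolding ev by blast
    obtain D' where D': "eventually D' V" "\<And>x y z. D' (x, y) \<Longrightarrow> D' (y, z) \<Longrightarrow> D (x, z)"
      using comp[OF D(1)] by blast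
    let ?C = "\<lambda>(x, y). x \<in> S \<and> y \<in> S \<and> D' (i x, i y)"
    have C: "eventually ?C ?U" unfolding ev using D'(1) by (intro exI[of _ D']) simp
    have CC: "E (x, z)" if "?C (x, y)" "?C (y, z)" for x y z
      using that D(2)[of x z] D'(2)[of "i x" "i y" "i z"] by simp
    show "\<exists>C. eventually C ?U \<and> (\<forall>x y z. C (x, y) \<longrightarrow> C (y, z) \<longrightarrow> E (x, z))"
      by (intro exI[of _ ?C] conjI allI impI C) (rule CC)
  qed
qed

lemma uniform_structure_berkovich:
  "uniform_structure (berkovich_line v) (berkovich_uniformity v)"
  unfolding uniform_structure_def
proof (intro conjI allI impI ballI)
  show "berkovich_uniformity v \<le> principal (berkovich_line v \<times> berkovich_line v)"
    unfolding le_principal eventually_berkovich_uniformity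
    by (intro exI[of _ "{0}"] exI[of _ 1]) (auto simp: berkovich_entourage_def)
next
  fix E x assume "eventually E (berkovich_uniformity v)" "x \<in> berkovich_line v"
  then show "E (x, x)"
    unfolding eventually_berkovich_uniformity by (auto simp: berkovich_entourage_def)
next
  fix E assume "eventually E (berkovich_uniformity v)"
  then obtain X \<epsilon> where X: "finite X" "X \<noteq> {}" "\<epsilon> > 0" and E: "\<forall>z\<in>berkovich_entourage v X \<epsilon>. E z"
    unfolding eventually_berkovich_uniformity by blast
  have "(\<nu>, \<mu>) \<in> berkovich_entourage v X \<epsilon>" if "(\<mu>, \<nu>) \<in> berkovich_entourage v X \<epsilon>" for \<mu> \<nu>
    using that by (simp add: berkovich_entourage_def abs_minus_commute)
  then have "\<forall>z\<in>berkovich_entourage v X \<epsilon>. case z of (x, y) \<Rightarrow> E (y, x)" using E by blast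
  then show "eventually (\<lambda>(x, y). E (y, x)) (berkovich_uniformity v)"
    unfolding eventually_berkovich_uniformity using X by blast
next
  fix E assume "eventually E (berkovich_uniformity v)"
  then obtain X \<epsilon> where X: "finite X" "X \<noteq> {}" "\<epsilon> > 0" and E: "\<forall>z\<in>berkovich_entourage v X \<epsilon>. E z"
    unfolding eventually_berkovich_uniformity by blast
  let ?D = "\<lambda>z. z \<in> berkovich_entourage v X (\<epsilon> / 2)"
  have "eventually ?D (berkovich_uniformity v)"
    unfolding eventually_berkovich_uniformity using X by (intro exI[of _ X] exI[of _ "\<epsilon> / 2"]) auto
  moreover have "E (\<mu>, \<kappa>)" if "?D (\<mu>, \<nu>)" "?D (\<nu>, \<kappa>)" for \<mu> \<nu> \<kappa>
  proof -
    have "\<bar>\<mu> p - \<kappa> p\<bar> < \<epsilon>" if "p \<in> X" for p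
    proof -
      have "\<bar>\<mu> p - \<nu> p\<bar> < \<epsilon> / 2" "\<bar>\<nu> p - \<kappa> p\<bar> < \<epsilon> / 2"
        using \<open>?D (\<mu>, \<nu>)\<close> \<open>?D (\<nu>, \<kappa>)\<close> that by (auto simp: berkovich_entourage_def)
      then show ?thesis by linarith
    qed
    then have "(\<mu>, \<kappa>) \<in> berkovich_entourage v X \<epsilon>"
      using that by (auto simp: berkovich_entourage_def)
    then show ?thesis using E by blast
  qed
  ultimately show "\<exists>D. eventually D (berkovich_uniformity v) \<and>
      (\<forall>x y z. D (x, y) \<longrightarrow> D (y, z) \<longrightarrow> E (x, z))" by blast
qed

lemma topspace_berkovich:
  "topspace (uniform_topology (berkovich_line v) (berkovich_uniformity v)) = berkovich_line v"
  by (rule topspace_uniform_topology[OF uniform_structure_berkovich])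

lemma openin_berkovich:
  "openin (uniform_topology (berkovich_line v) (berkovich_uniformity v)) W \<longleftrightarrow>
    W \<subseteq> berkovich_line v \<and>
    (\<forall>\<mu>\<in>W. \<exists>X \<epsilon>. finite X \<and> X \<noteq> {} \<and> \<epsilon> > 0 \<and>
       (\<forall>\<nu>\<in>berkovich_line v. (\<forall>p\<in>X. \<bar>\<mu> p - \<nu> p\<bar> < \<epsilon>) \<longrightarrow> \<nu> \<in> W))"
proof -
  have "(\<forall>z\<in>berkovich_entourage v X \<epsilon>. case z of (x', y) \<Rightarrow> x' = \<mu> \<longrightarrow> y \<in> W) \<longleftrightarrow>
      (\<forall>\<nu>\<in>berkovich_line v. (\<forall>p\<in>X. \<bar>\<mu> p - \<nu> p\<bar> < \<epsilon>) \<longrightarrow> \<nu> \<in> W)"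
    if "\<mu> \<in> berkovich_line v" for \<mu> X \<epsilon>
    using that unfolding berkovich_entourage_def by blast
  then show ?thesis
    unfolding openin_uniform_topology eventually_berkovich_uniformity
    by (intro conj_cong ball_cong refl) (simp add: subset_iff)
qed

lemma limitin_berkovich:
  assumes l: "l \<in> berkovich_line v" and f: "eventually (\<lambda>x. f x \<in> berkovich_line v) F"
    and lim: "\<And>p. ((\<lambda>x. f x p) \<longlongrightarrow> l p) F"
  shows "limitin (uniform_topology (berkovich_line v) (berkovich_uniformity v)) f l F"
  unfolding limitin_def topspace_berkovich
proof (intro conjI allI impI)
  fix W assume "openin (uniform_topology (berkovich_line v) (berkovich_uniformity v)) W \<and> l \<in> W"
  then obtain X \<epsilon> where X: "finite X" "\<epsilon> > 0"
    and W: "\<And>\<nu>. \<nu> \<in> berkovich_line v \<Longrightarrow> (\<forall>p\<in>X. \<bar>l p - \<nu> p\<bar> < \<epsilon>) \<Longrightarrow> \<nu> \<in> W"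
    unfolding openin_berkovich by blast
  have "eventually (\<lambda>x. \<bar>l p - f x p\<bar> < \<epsilon>) F" for p
    using tendstoD[OF lim X(2), of p] by (simp add: dist_real_def abs_minus_commute)
  then have "eventually (\<lambda>x. \<forall>p\<in>X. \<bar>l p - f x p\<bar> < \<epsilon>) F" using X by (simp add: eventually_ball_finite)
  with f show "eventually (\<lambda>x. f x \<in> W) F" by eventually_elim (rule W)
qed (rule l)

lemma Hausdorff_berkovich:
  "Hausdorff_space (uniform_topology (berkovich_line v) (berkovich_uniformity v))"
  unfolding Hausdorff_space_def topspace_berkovich
proof (intro allI impI)
  fix \<mu> \<nu> assume *: "\<mu> \<in> berkovich_line v \<and> \<nu> \<in> berkovich_line v \<and> \<mu> \<noteq> \<nu>"
  then obtain p where p: "\<mu> p \<noteq> \<nu> p" by blast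
  define \<delta> where "\<delta> = \<bar>\<mu> p - \<nu> p\<bar> / 2"
  have \<delta>: "\<delta> > 0" using p by (simp add: \<delta>_def)
  define B where "B c = {\<eta> \<in> berkovich_line v. \<bar>c - \<eta> p\<bar> < \<delta>}" for c
  have B: "openin (uniform_topology (berkovich_line v) (berkovich_uniformity v)) (B c)" for c
    unfolding openin_berkovich
  proof (intro conjI ballI)
    fix \<eta> assume \<eta>: "\<eta> \<in> B c"
    have "\<bar>c - \<kappa> p\<bar> < \<delta>" if "\<bar>\<eta> p - \<kappa> p\<bar> < \<delta> - \<bar>c - \<eta> p\<bar>" for \<kappa> using that by linarith
    then show "\<exists>X \<epsilon>. finite X \<and> X \<noteq> {} \<and> \<epsilon> > 0 \<and>
       (\<forall>\<kappa>\<in>berkovich_line v. (\<forall>p\<in>X. \<bar>\<eta> p - \<kappa> p\<bar> < \<epsilon>) \<longrightarrow> \<kappa> \<in> B c)"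
      using \<eta> by (intro exI[of _ "{p}"] exI[of _ "\<delta> - \<bar>c - \<eta> p\<bar>"]) (auto simp: B_def)
  qed (auto simp: B_def)
  have "disjnt (B (\<mu> p)) (B (\<nu> p))"
    unfolding disjnt_iff B_def
  proof (intro allI notI, clarify)
    fix \<eta> assume "\<bar>\<mu> p - \<eta> p\<bar> < \<delta>" "\<bar>\<nu> p - \<eta> p\<bar> < \<delta>"
    then have "\<bar>\<mu> p - \<nu> p\<bar> < 2 * \<delta>" by linarith
    then show False by (simp add: \<delta>_def)
  qed
  moreover have "\<mu> \<in> B (\<mu> p)" "\<nu> \<in> B (\<nu> p)" using * \<delta> by (auto simp: B_def)
  ultimately show "\<exists>U V. openin (uniform_topology (berkovich_line v) (berkovich_uniformity v)) U \<and>
      openin (uniform_topology (berkovich_line v) (berkovich_uniformity v)) V \<and>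
      \<mu> \<in> U \<and> \<nu> \<in> V \<and> disjnt U V"
    using B by blast
qed

text \<open>The defining conditions of the line are closed under pointwise limits (for the condition
  of being non-zero, in the form that \<open>1\<close> has value \<open>1\<close>), so a Cauchy filter converges to its
  pointwise limit.\<close>

lemma complete_berkovich:
  fixes v :: "'a::idom fract \<Rightarrow> real"
  shows "complete_uniform_structure (berkovich_line v) (berkovich_uniformity v)"
  unfolding complete_uniform_structure_def
proof (intro allI impI)
  fix F :: "('a poly \<Rightarrow> real) filter"
  assume F: "F \<noteq> bot" "F \<le> principal (berkovich_line v)" "F \<times>\<^sub>F F \<le> berkovich_uniformity v"
  have evT: "eventually (\<lambda>\<mu>. \<mu> \<in> berkovich_line v) F" using F(2) by (simp add: le_principal)
  have "\<exists>l. ((\<lambda>\<mu>. \<mu> p) \<longlongrightarrow> l) F" for p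
  proof -
    have "cauchy_filter (filtermap (\<lambda>\<mu>. \<mu> p) F)"
      unfolding cauchy_filter_metric_filtermap
    proof (intro allI impI)
      fix e :: real assume "e > 0"
      then have "eventually (\<lambda>z. z \<in> berkovich_entourage v {p} e) (berkovich_uniformity v)"
        unfolding eventually_berkovich_uniformity by (intro exI[of _ "{p}"] exI[of _ e]) auto
      then have "eventually (\<lambda>z. z \<in> berkovich_entourage v {p} e) (F \<times>\<^sub>F F)"
        using F(3) by (rule filter_leD[rotated])
      then obtain P where "eventually P F" "\<forall>x y. P x \<longrightarrow> P y \<longrightarrow> (x, y) \<in> berkovich_entourage v {p} e"
        unfolding eventually_prod_same by blast
      then show "\<exists>P. eventually P F \<and> (\<forall>x y. P x \<and> P y \<longrightarrow> dist (x p) (y p) < e)"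
        by (intro exI[of _ P]) (auto simp: berkovich_entourage_def dist_real_def)
    qed
    then have "\<exists>l. filtermap (\<lambda>\<mu>. \<mu> p) F \<le> nhds l"
      using complete_UNIV[where 'a = real] F(1)
      unfolding complete_uniform by (simp add: filtermap_bot_iff)
    then show ?thesis unfolding filterlim_def by blast
  qed
  then obtain l where l: "\<And>p. ((\<lambda>\<mu>. \<mu> p) \<longlongrightarrow> l p) F" by metis
  have "l \<in> berkovich_line v"
  proof -
    have eq: "x = y" if "(f \<longlongrightarrow> x) F" "(g \<longlongrightarrow> y) F" "\<And>\<mu>. \<mu> \<in> berkovich_line v \<Longrightarrow> f \<mu> = g \<mu>"
      for f g :: "('a poly \<Rightarrow> real) \<Rightarrow> real" and x y
    proof -
      have "eventually (\<lambda>\<mu>. f \<mu> = g \<mu>) F" using evT by (rule eventually_mono) (rule that(3))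
      with that(1) have "(g \<longlongrightarrow> x) F" by (rule Lim_transform_eventually)
      then show ?thesis using that(2) by (rule tendsto_unique[OF F(1)])
    qed
    have le: "x \<le> y" if "(f \<longlongrightarrow> x) F" "(g \<longlongrightarrow> y) F" "\<And>\<mu>. \<mu> \<in> berkovich_line v \<Longrightarrow> f \<mu> \<le> g \<mu>"
      for f g :: "('a poly \<Rightarrow> real) \<Rightarrow> real" and x y
      using tendsto_le[OF F(1) that(2,1)] evT that(3) by (metis (mono_tags, lifting) eventually_mono)
    have "l 0 = 0" by (rule eq[OF l tendsto_const]) (simp add: berkovich_lineD)
    moreover have "l p \<ge> 0" for p by (rule le[OF tendsto_const l]) (simp add: berkovich_lineD)
    moreover have "l (p + q) \<le> l p + l q" for p q
      by (rule le[OF l tendsto_add[OF l l]]) (simp add: berkovich_lineD)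
    moreover have "l (p * q) = l p * l q" for p q
      by (rule eq[OF l tendsto_mult[OF l l]]) (simp add: berkovich_lineD)
    moreover have "l 1 = 1" by (rule eq[OF l tendsto_const]) (simp add: berkovich_lineD)
    then have "\<exists>p. l p \<noteq> 0" by (metis zero_neq_one)
    moreover have "l [:a:] \<le> v (to_fract a)" for a
      by (rule le[OF l tendsto_const]) (simp add: berkovich_lineD)
    ultimately show ?thesis
      unfolding berkovich_line_def multiplicative_seminorm_def by blast
  qed
  then show "\<exists>l. limitin (uniform_topology (berkovich_line v) (berkovich_uniformity v)) (\<lambda>x. x) l F"
    using limitin_berkovich[of l v "\<lambda>x. x" F, OF _ evT l] by blast
qed

section \<open>The completion\<close>

lemma evaluation_seminorm_inj:
  fixes v :: "'a::idom fract \<Rightarrow> real"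
  assumes v: "induced_norm v" and c: "0 < v (to_fract c)" "v (to_fract c) < 1"
  shows "inj_on (evaluation_seminorm v) (UNIV \<times> {1<..})"
proof (rule inj_onI, clarify)
  fix s \<omega> s' \<omega>'
  assume eq: "evaluation_seminorm v (s, \<omega>) = evaluation_seminorm v (s', \<omega>')"
  have N: "nonarchimedean_abs v" using v unfolding induced_norm_iff by blast
  note D = nonarchimedean_absD[OF N]
  have eq': "v (poly (fract_poly p) s) powr \<omega> = v (poly (fract_poly p) s') powr \<omega>'" for p
    using fun_cong[OF eq, of p] by (simp add: evaluation_seminorm_def)
  have "v (to_fract c) powr \<omega> = v (to_fract c) powr \<omega>'"
    using eq'[of "[:c:]"] by (simp add: map_poly_pCons)
  then have "\<omega> = \<omega>'" using c by (simp add: powr_inj)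
  obtain x y where xy: "y \<noteq> 0" "s = to_fract x / to_fract y"
    by (cases s) (auto simp: Fract_conv_to_fract)
  have "poly (fract_poly [:- x, y:]) s = 0" using xy by (simp add: map_poly_pCons)
  then have "v (poly (fract_poly [:- x, y:]) s') = 0"
    using eq'[of "[:- x, y:]"] by (simp add: D(10))
  then have "s' * to_fract y - to_fract x = 0" using D(2) by (simp add: map_poly_pCons)
  moreover have "s * to_fract y = to_fract x" using xy by simp
  ultimately have "s' * to_fract y = s * to_fract y" by simp
  then have "s' = s" using xy(1) by simp
  with \<open>\<omega> = \<omega>'\<close> show "s = s' \<and> \<omega> = \<omega>'" by simp
qed

lemma evaluation_uniformity_pullback:
  fixes v :: "'a::idom fract \<Rightarrow> real"
  assumes v: "induced_norm v"
  shows "evaluation_uniformity v =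
    inf (filtercomap (map_prod (evaluation_seminorm v) (evaluation_seminorm v)) (berkovich_uniformity v))
      (principal ((UNIV \<times> {1<..}) \<times> (UNIV \<times> {1<..})))"
    (is "_ = inf (filtercomap (map_prod ?i ?i) _) (principal (?S \<times> ?S))")
proof (rule filter_eqI)
  fix P :: "('a fract \<times> real) \<times> ('a fract \<times> real) \<Rightarrow> bool"
  have ent: "z \<in> evaluation_entourage v X \<epsilon> \<longleftrightarrow> z \<in> ?S \<times> ?S \<and> map_prod ?i ?i z \<in> berkovich_entourage v X \<epsilon>"
    for z X \<epsilon>
    using evaluation_in_berkovich_line[OF v]
    by (cases z) (auto simp: evaluation_entourage_def berkovich_entourage_def evaluation_seminorm_def)
  show "eventually P (evaluation_uniformity v) \<longleftrightarrow>
      eventually P (inf (filtercomap (map_prod ?i ?i) (berkovich_uniformity v)) (principal (?S \<times> ?S)))"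
    (is "?L \<longleftrightarrow> ?R")
  proof
    assume ?L
    then obtain X \<epsilon> where X: "finite X" "X \<noteq> {}" "\<epsilon> > 0" and P: "\<forall>z\<in>evaluation_entourage v X \<epsilon>. P z"
      unfolding eventually_evaluation_uniformity by blast
    have "eventually (\<lambda>w. w \<in> berkovich_entourage v X \<epsilon>) (berkovich_uniformity v)"
      unfolding eventually_berkovich_uniformity using X by blast
    then show ?R
      unfolding eventually_inf_principal eventually_filtercomap using P ent by blast
  next
    assume ?R
    then obtain Q where Q: "eventually Q (berkovich_uniformity v)" "\<And>z. Q (map_prod ?i ?i z) \<Longrightarrow> z \<in> ?S \<times> ?S \<Longrightarrow> P z"
      unfolding eventually_inf_principal eventually_filtercomap by blast
    then obtain X \<epsilon> where X: "finite X" "X \<noteq> {}" "\<epsilon> > 0" and "\<forall>w\<in>berkovich_entourage v X \<epsilon>. Q w"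
      unfolding eventually_berkovich_uniformity by blast
    then have "\<forall>z\<in>evaluation_entourage v X \<epsilon>. P z" using ent Q(2) by blast
    then show ?L unfolding eventually_evaluation_uniformity using X by blast
  qed
qed

theorem mainTheorem3:
  fixes v :: "'a::idom fract \<Rightarrow> real"
  assumes "complete_valuation_ring v"
    and not_field: "\<exists>a::'a. a \<noteq> 0 \<and> \<not> a dvd 1"
    and alg_closed: "\<And>p :: 'a fract poly. degree p > 0 \<Longrightarrow> \<exists>x. poly p x = 0"
  shows "is_completion
           (UNIV \<times> {1<..}) (evaluation_uniformity v)
           (berkovich_line v) (berkovich_uniformity v)
           (evaluation_seminorm v)"
proof -
  have v: "induced_norm v" using assms(1) unfolding complete_valuation_ring_def by blast
  then have N: "nonarchimedean_abs v" and R: "range to_fract = {x. v x \<le> 1}"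
    unfolding induced_norm_iff by blast+
  note D = nonarchimedean_absD[OF N]
  let ?S = "UNIV \<times> {1<..} :: ('a fract \<times> real) set"
  let ?\<T> = "uniform_topology (berkovich_line v) (berkovich_uniformity v)"
  obtain c :: 'a where c: "c \<noteq> 0" "\<not> c dvd 1" using not_field by blast
  have c0: "v (to_fract c) > 0" using c D(1)[of "to_fract c"] D(2)[of "to_fract c"] by auto
  have c1: "v (to_fract c) < 1"
  proof (rule ccontr)
    assume "\<not> v (to_fract c) < 1"
    then have "v (1 / to_fract c) \<le> 1" using c by (simp add: D(5,11))
    then obtain b where "1 / to_fract c = to_fract b" using R by blast
    then have "to_fract 1 = to_fract (c * b)" using c by (simp add: field_simps)
    then have "1 = c * b" by (simp only: to_fract_eq_iff)
    then show False using c by (metis dvd_triv_left)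
  qed
  have dense: "\<exists>x. lo < v x \<and> v x < hi" if "0 \<le> lo" "lo < hi" for lo hi
    using algebraically_closed_dense_values[OF N alg_closed c0 c1 that] by blast
  have into: "evaluation_seminorm v ` ?S \<subseteq> berkovich_line v"
    using evaluation_in_berkovich_line[OF v] by auto
  have "\<mu> \<in> ?\<T> closure_of (evaluation_seminorm v ` ?S)" if \<mu>: "\<mu> \<in> berkovich_line v" for \<mu>
  proof -
    have "\<exists>s \<omega>. (\<forall>n. \<omega> n > (1::real)) \<and> (\<forall>p. (\<lambda>n. evaluation_seminorm v (s n, \<omega> n) p) \<longlonglongrightarrow> \<mu> p)"
    proof (rule berkovich_line_constants[OF v \<mu> c0 c1])
      fix \<omega> assume \<omega>: "\<omega> \<ge> 1" "\<And>a. \<mu> [:a:] = v (to_fract a) powr \<omega>"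
      show ?thesis
        by (rule berkovich_line_limit_finite_exponent[OF v _ _ \<mu> \<omega>]) (use alg_closed dense in blast)+
    next
      assume trivial: "\<And>a. \<mu> [:a:] = (if v (to_fract a) < 1 then 0 else 1)"
      show ?thesis
        by (rule berkovich_line_limit_infinite_exponent[OF v _ _ \<mu> trivial]) (use alg_closed dense in blast)+
    qed
    then obtain s \<omega> where \<omega>: "\<And>n. \<omega> n > (1::real)"
      and lim: "\<And>p. (\<lambda>n. evaluation_seminorm v (s n, \<omega> n) p) \<longlonglongrightarrow> \<mu> p"
      by blast
    have "limitin ?\<T> (\<lambda>n. evaluation_seminorm v (s n, \<omega> n)) \<mu> sequentially"
      by (rule limitin_berkovich[OF \<mu> _ lim])
        (simp add: evaluation_in_berkovich_line[OF v \<omega>])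
    moreover have "evaluation_seminorm v (s n, \<omega> n) \<in> evaluation_seminorm v ` ?S" for n
      using \<omega> by simp
    ultimately show ?thesis
      unfolding in_closure_of limitin_def
      by (metis (mono_tags, lifting) eventually_happens' sequentially_bot)
  qed
  then have dense_image: "?\<T> closure_of (evaluation_seminorm v ` ?S) = berkovich_line v"
    using closure_of_subset_topspace[of ?\<T>] unfolding topspace_berkovich by blast
  show ?thesis
    unfolding is_completion_def
    by (intro conjI uniform_structure_berkovich complete_berkovich Hausdorff_berkovich into
        evaluation_seminorm_inj[OF v c0 c1] evaluation_uniformity_pullback[OF v] dense_image)
      (unfold evaluation_uniformity_pullback[OF v],
        rule uniform_structure_pullback[OF uniform_structure_berkovich into])
qed

end
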